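(* Let $\{A_n\}_{n\ge0}$ be a sequence of contractions on a complex Hilbert space $\mathcal{H}$ with $A_0=I$, admitting an isometric dilation. Define operators $V_{ij}$ on $\mathcal{H}$ ($i,j\ge0$) column by column as follows. Put $V_{ij}=0$ for $i>j+1$, $V_{00}=A_1$, $V_{10}=(I-A_1^*A_1)^{1/2}$, and for $n=1,2,3,\dots$ successively $$V_{0n}=\Big[A_{n+1}-\sum_{(r_1,\dots,r_n),\ r_1\ne n}V_{0r_1}V_{r_1r_2}\cdots V_{r_n0}\Big]\big(V_{n(n-1)}V_{(n-1)(n-2)}\cdots V_{10}\big)^{-1},$$ $$V_{kn}=-\big(V_{k(k-1)}^*\big)^{-1}\sum_{i=0}^{k-1}V_{i(k-1)}^*V_{in}\quad(0<k\le n),\qquad V_{(n+1)n}=\Big[I-\sum_{i=0}^nV_{in}^*V_{in}\Big]^{1/2},$$ where the sum in the first formula runs over tuples of integers $0\le r_1,\dots,r_n\le n$ with $r_1\neq n$ such that $r_i-r_{i+1}\le1$ for $1\le i\le n$ (with $r_{n+1}=0$). If the inverses appearing in these recurrence relations are well-defined bounded operators, then these formulae provide a minimal isometric dilation of $\{A_n\}_{n\ge0}$: the block matrix $$V=\begin{bmatrix}V_{00}&V_{01}&V_{02}&V_{03}&\cdots\\ V_{10}&V_{11}&V_{12}&V_{13}&\cdots\\ 0&V_{21}&V_{22}&V_{23}&\cdots\\ 0&0&V_{32}&V_{33}&\cdots\\ \vdots&\vdots&\vdots&\ddots&\ddots\end{bmatrix}$$ on $\mathcal{K}=\mathcal{H}\oplus\mathcal{H}\oplus\mathcal{H}\oplus\cdots$,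 with $\mathcal{H}$ identified with the $0$-th summand, is well defined and is a minimal isometric dilation of $\{A_n\}_{n\ge0}$.
   Context: An isometric dilation of $\{A_n\}_{n\ge0}$ is an isometry $V$ on a Hilbert space $\mathcal{K}\supseteq\mathcal{H}$ such that $A_n=P_{\mathcal{H}}V^n|_{\mathcal{H}}$ for all $n\ge0$, with $P_{\mathcal{H}}$ the orthogonal projection onto $\mathcal{H}$; it is minimal if $\mathcal{K}=\overline{\mathrm{span}}\{V^nh:h\in\mathcal{H},n\ge0\}$. The restriction $r_i-r_{i+1}\le1$ only discards products that contain a zero factor $V_{ij}$ with $i>j+1$; with it, the sum involves only entries from columns $0,\dots,n-1$. Square roots are positive square roots. *)

theory Defs
  imports "HOL-Analysis.Analysis"
begin

section \<open>Complex Hilbert spaces\<close>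

text \<open>
  The real structure (norm, topology, completeness) is the one of \<^class>\<open>real_inner\<close> and
  \<^class>\<open>complete_space\<close>; the complex inner product, linear in its first argument, has the
  real inner product as its real part and hence induces the same norm.
\<close>

class complex_hilbert = real_inner + complete_space +
  fixes scaleC :: "complex \<Rightarrow> 'a \<Rightarrow> 'a" (infixr \<open>*\<^sub>C\<close> 75)
    and cinner :: "'a \<Rightarrow> 'a \<Rightarrow> complex"
  assumes scaleC_add_right: "a *\<^sub>C (x + y) = a *\<^sub>C x + a *\<^sub>C y"
    and scaleC_add_left: "(a + b) *\<^sub>C x = a *\<^sub>C x + b *\<^sub>C x"
    and scaleC_scaleC: "a *\<^sub>C b *\<^sub>C x = (a * b) *\<^sub>C x"
    and scaleC_one: "1 *\<^sub>C x = x"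
    and scaleR_scaleC: "r *\<^sub>R x = complex_of_real r *\<^sub>C x"
    and cinner_commute: "cinner x y = cnj (cinner y x)"
    and cinner_add_left: "cinner (x + y) z = cinner x z + cinner y z"
    and cinner_scaleC_left: "cinner (a *\<^sub>C x) y = a * cinner x y"
    and Re_cinner: "Re (cinner x y) = inner x y"

instantiation complex :: complex_hilbert
begin

definition "scaleC_complex = ((*) :: complex \<Rightarrow> complex \<Rightarrow> complex)"
definition "cinner_complex (x :: complex) y = x * cnj y"

instance
  by standard
     (simp_all add: scaleC_complex_def cinner_complex_def algebra_simps scaleR_conv_of_real
       inner_complex_def)

end

global_interpretation complex_vector: vector_space "scaleC :: complex \<Rightarrow> 'a \<Rightarrow> 'a::complex_hilbert"
  by standard (simp_all add: scaleC_add_right scaleC_add_left scaleC_scaleC scaleC_one)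

abbreviation clinear :: "('a::complex_hilbert \<Rightarrow> 'b::complex_hilbert) \<Rightarrow> bool" where
  "clinear \<equiv> Vector_Spaces.linear scaleC scaleC"

definition clinear_isometry :: "('a::complex_hilbert \<Rightarrow> 'b::complex_hilbert) \<Rightarrow> bool" where
  "clinear_isometry f \<longleftrightarrow> clinear f \<and> (\<forall>x. norm (f x) = norm x)"

definition orth_proj :: "'a::complex_hilbert set \<Rightarrow> 'a \<Rightarrow> 'a" where
  "orth_proj M x = (THE y. y \<in> M \<and> (\<forall>z\<in>M. cinner (x - y) z = 0))"


section \<open>Bounded operators\<close>

text \<open>
  Elements of \<open>'a \<Rightarrow>\<^sub>L 'a\<close> are only real linear; complex linearity is a separate condition.
  Adjoints and two-sided inverses of complex linear operators are complex linear automatically,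
  and so are positive square roots by the definition of positivity.
  The operators defined by \<open>THE\<close> are unspecified where they do not exist.
\<close>

definition op_adjoint :: "'a::complex_hilbert \<Rightarrow>\<^sub>L 'a \<Rightarrow> 'a \<Rightarrow>\<^sub>L 'a" where
  "op_adjoint T = (THE S :: 'a \<Rightarrow>\<^sub>L 'a. \<forall>x y. cinner (T x) y = cinner x (S y))"

definition op_positive :: "'a::complex_hilbert \<Rightarrow>\<^sub>L 'a \<Rightarrow> bool" where
  "op_positive T \<longleftrightarrow> clinear T \<and> (\<forall>x. cinner (T x) x \<in> \<real> \<and> 0 \<le> Re (cinner (T x) x))"

definition op_sqrt :: "'a::complex_hilbert \<Rightarrow>\<^sub>L 'a \<Rightarrow> 'a \<Rightarrow>\<^sub>L 'a" where
  "op_sqrt T = (THE S. op_positive S \<and> S o\<^sub>L S = T)"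

definition is_op_inverse :: "'a::complex_hilbert \<Rightarrow>\<^sub>L 'a \<Rightarrow> 'a \<Rightarrow>\<^sub>L 'a \<Rightarrow> bool" where
  "is_op_inverse T S \<longleftrightarrow> S o\<^sub>L T = id_blinfun \<and> T o\<^sub>L S = id_blinfun"

definition op_invertible :: "'a::complex_hilbert \<Rightarrow>\<^sub>L 'a \<Rightarrow> bool" where
  "op_invertible T \<longleftrightarrow> (\<exists>S. is_op_inverse T S)"

definition op_inverse :: "'a::complex_hilbert \<Rightarrow>\<^sub>L 'a \<Rightarrow> 'a \<Rightarrow>\<^sub>L 'a" where
  "op_inverse T = (THE S. is_op_inverse T S)"


section \<open>Isometric dilations\<close>

text \<open>
  The inclusion of \<open>\<H>\<close> in \<open>\<K>\<close> is given by a linear isometry \<open>J\<close>, so that \<open>\<H>\<close> is the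
  closed subspace \<open>range J\<close> of \<open>\<K>\<close>.
\<close>

definition isometric_dilation ::
  "(nat \<Rightarrow> 'h::complex_hilbert \<Rightarrow>\<^sub>L 'h) \<Rightarrow> ('h \<Rightarrow> 'k::complex_hilbert) \<Rightarrow> ('k \<Rightarrow> 'k) \<Rightarrow> bool" where
  "isometric_dilation A J V \<longleftrightarrow> clinear_isometry J \<and> clinear_isometry V \<and>
     (\<forall>n h. J (A n h) = orth_proj (range J) ((V ^^ n) (J h)))"

definition minimal_isometric_dilation ::
  "(nat \<Rightarrow> 'h::complex_hilbert \<Rightarrow>\<^sub>L 'h) \<Rightarrow> ('h \<Rightarrow> 'k::complex_hilbert) \<Rightarrow> ('k \<Rightarrow> 'k) \<Rightarrow> bool" where
  "minimal_isometric_dilation A J V \<longleftrightarrow> isometric_dilation A J V \<and>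
     closure (complex_vector.span {(V ^^ n) (J h) |n h. True}) = UNIV"


section \<open>The recurrence\<close>

text \<open>\<open>path_prod V [i\<^sub>0, \<dots>, i\<^sub>m] = V i\<^sub>0 i\<^sub>1 \<cdot> V i\<^sub>1 i\<^sub>2 \<cdots> V i\<^sub>m\<^sub>-\<^sub>1 i\<^sub>m\<close>\<close>

fun path_prod :: "(nat \<Rightarrow> nat \<Rightarrow> 'a::real_normed_vector \<Rightarrow>\<^sub>L 'a) \<Rightarrow> nat list \<Rightarrow> 'a \<Rightarrow>\<^sub>L 'a" where
  "path_prod V (i # j # is) = V i j o\<^sub>L path_prod V (j # is)"
| "path_prod V is = id_blinfun"

text \<open>The tuples \<open>(r\<^sub>1, \<dots>, r\<^sub>n)\<close> of the first formula as lists; \<open>rs @ [0]\<close> accounts for \<open>r\<^sub>n\<^sub>+\<^sub>1 = 0\<close>.\<close>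

definition tuples :: "nat \<Rightarrow> nat list set" where
  "tuples n = {rs. length rs = n \<and> set rs \<subseteq> {0..n} \<and> hd rs \<noteq> n \<and>
     (\<forall>i<n. int ((rs @ [0]) ! i) - int ((rs @ [0]) ! Suc i) \<le> 1)}"

lemma path_prod_cong [fundef_cong]:
  assumes "xs = ys" "\<And>i. Suc i < length ys \<Longrightarrow> f (ys ! i) (ys ! Suc i) = g (ys ! i) (ys ! Suc i)"
  shows "path_prod f xs = path_prod g ys"
proof -
  have "path_prod f ys = path_prod g ys"
    using assms(2)
  proof (induction g ys rule: path_prod.induct)
    case (1 g i j "is")
    have "f i j = g i j" using 1(2)[of 0] by simp
    moreover have "path_prod f (j # is) = path_prod g (j # is)"
      by (rule 1(1)) (use 1(2)[of "Suc _"] in auto)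
    ultimately show ?case by simp
  qed simp_all
  then show ?thesis using assms(1) by simp
qed

lemma tuples_nth_less:
  assumes "rs \<in> tuples n" "0 < n" "Suc i < length (0 # rs @ [0])"
  shows "(0 # rs @ [0]) ! Suc i < n"
proof -
  have len: "length rs = n" and le: "set rs \<subseteq> {0..n}" and hd: "hd rs \<noteq> n"
    and step: "\<And>i. i < n \<Longrightarrow> (rs @ [0]) ! i \<le> Suc ((rs @ [0]) ! Suc i)"
    using assms(1) by (fastforce simp: tuples_def)+
  have bound: "(rs @ [0]) ! (n - d) \<le> d" if "d \<le> n" for d
    using that
  proof (induction d)
    case 0
    then show ?case using len by (simp add: nth_append)
  next
    case (Suc d)
    then have "Suc (n - Suc d) = n - d" by simp
    then show ?case using step[of "n - Suc d"] Suc by simp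
  qed
  have i: "i \<le> n" using assms(3) len by simp
  show ?thesis
  proof (cases "i = 0")
    case True
    have "rs ! 0 \<noteq> n" "rs ! 0 \<in> set rs" using hd len assms(2) by (auto simp: hd_conv_nth)
    then have "rs ! 0 < n" using le by fastforce
    then show ?thesis using True len assms(2) by (simp add: nth_append)
  next
    case False
    have "(rs @ [0]) ! i \<le> n - i" using bound[of "n - i"] i by simp
    then show ?thesis using False i assms(2) by simp
  qed
qed

lemma finite_tuples: "finite (tuples n)"
  by (rule finite_subset[OF _ finite_lists_length_eq[of "{0..n}" n]]) (auto simp: tuples_def)

text \<open>
  Each entry depends only on entries of preceding columns and on entries above it in its own column.
  Note \<open>rev [0..<n + 1] = [n, n - 1, \<dots>, 0]\<close>.
\<close>

function dilation_entry ::
  "(nat \<Rightarrow> 'h::complex_hilbert \<Rightarrow>\<^sub>L 'h) \<Rightarrow> nat \<Rightarrow> nat \<Rightarrow> 'h \<Rightarrow>\<^sub>L 'h" where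
  "dilation_entry A k n =
    (if k > n + 1 then 0
     else if n = 0 then
       (if k = 0 then A 1 else op_sqrt (id_blinfun - (op_adjoint (A 1) o\<^sub>L A 1)))
     else if k = 0 then
       (A (n + 1) - (\<Sum>rs\<in>tuples n. path_prod (\<lambda>i j. dilation_entry A i j) (0 # rs @ [0])))
         o\<^sub>L op_inverse (path_prod (\<lambda>i j. dilation_entry A i j) (rev [0..<n + 1]))
     else if k \<le> n then
       - (op_inverse (op_adjoint (dilation_entry A k (k - 1)))
           o\<^sub>L (\<Sum>i = 0..k - 1. op_adjoint (dilation_entry A i (k - 1)) o\<^sub>L dilation_entry A i n))
     else
       op_sqrt (id_blinfun
         - (\<Sum>i = 0..n. op_adjoint (dilation_entry A i n) o\<^sub>L dilation_entry A i n)))"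
  by pat_completeness auto
termination
proof (relation "measures [\<lambda>(A, k, n). n, \<lambda>(A, k, n). k]", goal_cases)
  case (2 A k n rs i)
  then show ?case using tuples_nth_less[of rs n i] by simp
next
  case (3 A k n i)
  then show ?case by (simp add: rev_nth)
qed auto

declare dilation_entry.simps [simp del]

section \<open>The Hilbert space \<open>\<H> \<oplus> \<H> \<oplus> \<H> \<oplus> \<cdots>\<close>\<close>

typedef (overloaded) 'a l2 = "{f :: nat \<Rightarrow> 'a::real_normed_vector. summable (\<lambda>n. (norm (f n))\<^sup>2)}"
  morphisms l2_nth Abs_l2
  by (rule exI[of _ "\<lambda>_. 0"]) simp

setup_lifting type_definition_l2

lemma summable_l2_add:
  fixes f g :: "nat \<Rightarrow> 'a::real_normed_vector"
  assumes "summable (\<lambda>n. (norm (f n))\<^sup>2)" "summable (\<lambda>n. (norm (g n))\<^sup>2)"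
  shows "summable (\<lambda>n. (norm (f n + g n))\<^sup>2)"
proof (rule summable_comparison_test'[where N = 0])
  show "summable (\<lambda>n. 2 * (norm (f n))\<^sup>2 + 2 * (norm (g n))\<^sup>2)"
    by (intro summable_add summable_mult assms)
  fix n
  have "(norm (f n + g n))\<^sup>2 \<le> (norm (f n) + norm (g n))\<^sup>2"
    by (intro power_mono norm_triangle_ineq) simp
  also have "\<dots> \<le> 2 * (norm (f n))\<^sup>2 + 2 * (norm (g n))\<^sup>2"
    using sum_squares_bound[of "norm (f n)" "norm (g n)"] by (simp add: power2_sum)
  finally show "norm ((norm (f n + g n))\<^sup>2) \<le> 2 * (norm (f n))\<^sup>2 + 2 * (norm (g n))\<^sup>2"
    by simp
qed

lemma summable_l2_mult:
  fixes f g :: "nat \<Rightarrow> 'a::real_normed_vector"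
  assumes "summable (\<lambda>n. (norm (f n))\<^sup>2)" "summable (\<lambda>n. (norm (g n))\<^sup>2)"
  shows "summable (\<lambda>n. norm (f n) * norm (g n))"
proof (rule summable_comparison_test'[where N = 0])
  show "summable (\<lambda>n. (norm (f n))\<^sup>2 + (norm (g n))\<^sup>2)"
    by (intro summable_add assms)
  fix n
  have "2 * (norm (f n) * norm (g n)) \<le> (norm (f n))\<^sup>2 + (norm (g n))\<^sup>2"
    using sum_squares_bound[of "norm (f n)" "norm (g n)"] by simp
  moreover have "0 \<le> norm (f n) * norm (g n)" by simp
  ultimately show "norm (norm (f n) * norm (g n)) \<le> (norm (f n))\<^sup>2 + (norm (g n))\<^sup>2"
    unfolding real_norm_def abs_mult abs_norm_cancel by linarith
qed

lemma summable_l2_inner: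
  fixes f g :: "nat \<Rightarrow> 'a::real_inner"
  assumes "summable (\<lambda>n. (norm (f n))\<^sup>2)" "summable (\<lambda>n. (norm (g n))\<^sup>2)"
  shows "summable (\<lambda>n. inner (f n) (g n))"
  by (rule summable_comparison_test'[where N = 0, OF summable_l2_mult[OF assms]])
     (simp add: Cauchy_Schwarz_ineq2)

instantiation l2 :: (real_normed_vector) real_vector
begin

lift_definition zero_l2 :: "'a l2" is "\<lambda>_. 0" by simp
lift_definition uminus_l2 :: "'a l2 \<Rightarrow> 'a l2" is "\<lambda>f n. - f n" by simp
lift_definition plus_l2 :: "'a l2 \<Rightarrow> 'a l2 \<Rightarrow> 'a l2" is "\<lambda>f g n. f n + g n"
  by (rule summable_l2_add)
lift_definition minus_l2 :: "'a l2 \<Rightarrow> 'a l2 \<Rightarrow> 'a l2" is "\<lambda>f g n. f n - g n"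
  using summable_l2_add[of _ "\<lambda>n. - _ n"] by simp
lift_definition scaleR_l2 :: "real \<Rightarrow> 'a l2 \<Rightarrow> 'a l2" is "\<lambda>r f n. r *\<^sub>R f n"
  by (simp add: power_mult_distrib summable_mult)

instance
  by (standard; transfer; simp add: algebra_simps)

end

instantiation l2 :: (real_inner) real_inner
begin

lift_definition inner_l2 :: "'a l2 \<Rightarrow> 'a l2 \<Rightarrow> real" is "\<lambda>f g. \<Sum>n. inner (f n) (g n)" .

definition norm_l2 :: "'a l2 \<Rightarrow> real" where
  "norm_l2 f = sqrt (inner f f)"
definition sgn_l2 :: "'a l2 \<Rightarrow> 'a l2" where
  "sgn_l2 f = f /\<^sub>R norm f"
definition dist_l2 :: "'a l2 \<Rightarrow> 'a l2 \<Rightarrow> real" where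
  "dist_l2 f g = norm (f - g)"
definition uniformity_l2 :: "('a l2 \<times> 'a l2) filter" where
  "uniformity_l2 = (INF e\<in>{0 <..}. principal {(x, y). dist x y < e})"
definition open_l2 :: "'a l2 set \<Rightarrow> bool" where
  "open_l2 S = (\<forall>x\<in>S. \<forall>\<^sub>F (x', y) in uniformity. x' = x \<longrightarrow> y \<in> S)"

instance
proof
  fix f g h :: "'a l2" and r :: real
  show "inner f g = inner g f"
    by transfer (simp add: inner_commute)
  show "inner (f + g) h = inner f h + inner g h"
    by transfer (simp add: inner_add_left suminf_add summable_l2_inner)
  show "inner (r *\<^sub>R f) g = r * inner f g"
    by transfer (simp add: suminf_mult summable_l2_inner)
  show "0 \<le> inner f f"
    by transfer (simp add: suminf_nonneg summable_l2_inner)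
  show "inner f f = 0 \<longleftrightarrow> f = 0"
    by transfer (auto simp: suminf_eq_zero_iff summable_l2_inner)
qed (simp_all add: norm_l2_def sgn_l2_def dist_l2_def uniformity_l2_def open_l2_def)

end

lemma norm_l2_eq: "(norm f)\<^sup>2 = (\<Sum>n. (norm (l2_nth f n))\<^sup>2)"
  unfolding power2_norm_eq_inner by transfer simp

lemma summable_l2_nth: "summable (\<lambda>n. (norm (l2_nth f n))\<^sup>2)"
  using l2_nth[of f] by simp

lemma norm_l2_nth_le: "norm (l2_nth f n) \<le> norm f"
proof (rule power2_le_imp_le)
  have "(\<Sum>i\<in>{n}. (norm (l2_nth f i))\<^sup>2) \<le> (norm f)\<^sup>2"
    unfolding norm_l2_eq by (rule sum_le_suminf[OF summable_l2_nth]) auto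
  then show "(norm (l2_nth f n))\<^sup>2 \<le> (norm f)\<^sup>2" by simp
qed simp

instance l2 :: ("{real_inner, complete_space}") complete_space
proof
  fix X :: "nat \<Rightarrow> 'a l2"
  assume X: "Cauchy X"
  have "Cauchy (\<lambda>m. l2_nth (X m) n)" for n
  proof (rule metric_CauchyI)
    fix e :: real assume "0 < e"
    then obtain M where "\<And>m k. m \<ge> M \<Longrightarrow> k \<ge> M \<Longrightarrow> dist (X m) (X k) < e"
      using metric_CauchyD[OF X] by blast
    moreover have "dist (l2_nth (X m) n) (l2_nth (X k) n) \<le> dist (X m) (X k)" for m k
      using norm_l2_nth_le[of "X m - X k" n] by (simp add: dist_norm minus_l2.rep_eq)
    ultimately show "\<exists>M. \<forall>m\<ge>M. \<forall>k\<ge>M. dist (l2_nth (X m) n) (l2_nth (X k) n) < e"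
      using le_less_trans by blast
  qed
  then obtain f where f: "\<And>n. (\<lambda>m. l2_nth (X m) n) \<longlonglongrightarrow> f n"
    unfolding Cauchy_convergent_iff convergent_def by metis
  have *: "\<exists>M. \<forall>m\<ge>M. \<forall>N. (\<Sum>n<N. (norm (l2_nth (X m) n - f n))\<^sup>2) \<le> e\<^sup>2" if "0 < e" for e :: real
  proof -
    obtain M where M: "\<And>m k. m \<ge> M \<Longrightarrow> k \<ge> M \<Longrightarrow> dist (X m) (X k) < e"
      using metric_CauchyD[OF X \<open>0 < e\<close>] by blast
    have "(\<Sum>n<N. (norm (l2_nth (X m) n - f n))\<^sup>2) \<le> e\<^sup>2" if "m \<ge> M" for m N
    proof (rule LIMSEQ_le_const2)
      show "(\<lambda>k. \<Sum>n<N. (norm (l2_nth (X m) n - l2_nth (X k) n))\<^sup>2)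
          \<longlonglongrightarrow> (\<Sum>n<N. (norm (l2_nth (X m) n - f n))\<^sup>2)"
        by (intro tendsto_intros f)
      have "(\<Sum>n<N. (norm (l2_nth (X m) n - l2_nth (X k) n))\<^sup>2) \<le> e\<^sup>2" if "k \<ge> M" for k
      proof -
        have "(\<Sum>n<N. (norm (l2_nth (X m - X k) n))\<^sup>2) \<le> (norm (X m - X k))\<^sup>2"
          unfolding norm_l2_eq by (rule sum_le_suminf[OF summable_l2_nth]) auto
        also have "\<dots> \<le> e\<^sup>2"
          using M[OF \<open>m \<ge> M\<close> \<open>k \<ge> M\<close>] by (intro power_mono) (auto simp: dist_norm)
        finally show ?thesis by (simp add: minus_l2.rep_eq)
      qed
      then show "\<exists>K. \<forall>k\<ge>K. (\<Sum>n<N. (norm (l2_nth (X m) n - l2_nth (X k) n))\<^sup>2) \<le> e\<^sup>2"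
        by blast
    qed
    then show ?thesis by blast
  qed
  have **: "summable (\<lambda>n. (norm (l2_nth (X m) n - f n))\<^sup>2)"
    if "\<And>N. (\<Sum>n<N. (norm (l2_nth (X m) n - f n))\<^sup>2) \<le> e" for m e
    using that by (intro summableI_nonneg_bounded) auto
  obtain m where "summable (\<lambda>n. (norm (l2_nth (X m) n - f n))\<^sup>2)"
    using *[of 1] ** by fastforce
  then have "summable (\<lambda>n. (norm (f n - l2_nth (X m) n))\<^sup>2)"
    by (simp add: norm_minus_commute)
  from summable_l2_add[OF this summable_l2_nth[of "X m"]]
  have "summable (\<lambda>n. (norm (f n))\<^sup>2)" by simp
  then have L: "l2_nth (Abs_l2 f) = f"
    by (simp add: Abs_l2_inverse)
  have "X \<longlonglongrightarrow> Abs_l2 f"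
  proof (rule metric_LIMSEQ_I)
    fix r :: real assume "0 < r"
    then have "0 < r / 2" by simp
    from *[OF this] obtain M where
      M: "\<And>m N. m \<ge> M \<Longrightarrow> (\<Sum>n<N. (norm (l2_nth (X m) n - f n))\<^sup>2) \<le> (r / 2)\<^sup>2" by blast
    have "dist (X m) (Abs_l2 f) < r" if "m \<ge> M" for m
    proof -
      have "(norm (X m - Abs_l2 f))\<^sup>2 \<le> (r / 2)\<^sup>2"
        unfolding norm_l2_eq
        by (rule suminf_le_const[OF summable_l2_nth])
           (use M[OF \<open>m \<ge> M\<close>] in \<open>simp add: minus_l2.rep_eq L\<close>)
      then have "norm (X m - Abs_l2 f) \<le> r / 2"
        by (rule power2_le_imp_le) (use \<open>0 < r\<close> in simp)
      then show ?thesis using \<open>0 < r\<close> by (simp add: dist_norm)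
    qed
    then show "\<exists>M. \<forall>m\<ge>M. dist (X m) (Abs_l2 f) < r" by blast
  qed
  then show "convergent X" by (rule convergentI)
qed

lemma norm_scaleC: "norm (a *\<^sub>C x) = cmod a * norm (x :: 'a::complex_hilbert)"
proof -
  have "cinner (a *\<^sub>C x) (a *\<^sub>C x) = (a * cnj a) * cinner x x"
    by (metis (no_types, lifting) cinner_commute cinner_scaleC_left complex_cnj_mult mult.assoc)
  then have "Re (cinner (a *\<^sub>C x) (a *\<^sub>C x)) = (cmod a)\<^sup>2 * Re (cinner x x)"
    by (simp add: complex_mult_cnj cmod_power2)
  then show ?thesis
    by (simp add: norm_eq_sqrt_inner Re_cinner real_sqrt_mult)
qed

lemma norm_cinner_le: "cmod (cinner x y) \<le> 2 * (norm x * norm (y :: 'a::complex_hilbert))"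
proof -
  have "Im (cinner x y) = Re (cinner ((- \<i>) *\<^sub>C x) y)"
    by (simp only: cinner_scaleC_left) simp
  then have "\<bar>Im (cinner x y)\<bar> \<le> norm x * norm y"
    using Cauchy_Schwarz_ineq2[of "(- \<i>) *\<^sub>C x" y]
    by (simp only: Re_cinner norm_scaleC norm_minus_cancel norm_ii mult_1)
  moreover have "\<bar>Re (cinner x y)\<bar> \<le> norm x * norm y"
    by (simp add: Re_cinner Cauchy_Schwarz_ineq2)
  ultimately show ?thesis using cmod_le[of "cinner x y"] by linarith
qed

lemma summable_l2_cinner:
  fixes f g :: "nat \<Rightarrow> 'a::complex_hilbert"
  assumes "summable (\<lambda>n. (norm (f n))\<^sup>2)" "summable (\<lambda>n. (norm (g n))\<^sup>2)"
  shows "summable (\<lambda>n. cinner (f n) (g n))"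
  by (rule summable_comparison_test'[where N = 0, OF summable_mult[OF summable_l2_mult[OF assms], of 2]])
     (simp add: norm_cinner_le)

instantiation l2 :: (complex_hilbert) complex_hilbert
begin

lift_definition scaleC_l2 :: "complex \<Rightarrow> 'a l2 \<Rightarrow> 'a l2" is "\<lambda>a f n. a *\<^sub>C f n"
  by (simp add: norm_scaleC power_mult_distrib summable_mult)

lift_definition cinner_l2 :: "'a l2 \<Rightarrow> 'a l2 \<Rightarrow> complex" is "\<lambda>f g. \<Sum>n. cinner (f n) (g n)" .

instance
proof
  fix a b :: complex and r :: real and f g h :: "'a l2"
  show "a *\<^sub>C (f + g) = a *\<^sub>C f + a *\<^sub>C g"
    by transfer (simp add: scaleC_add_right)
  show "(a + b) *\<^sub>C f = a *\<^sub>C f + b *\<^sub>C f"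
    by transfer (simp add: scaleC_add_left)
  show "a *\<^sub>C b *\<^sub>C f = (a * b) *\<^sub>C f"
    by transfer (simp add: scaleC_scaleC)
  show "1 *\<^sub>C f = f"
    by transfer (simp add: scaleC_one)
  show "r *\<^sub>R f = complex_of_real r *\<^sub>C f"
    by transfer (simp add: scaleR_scaleC)
  show "cinner f g = cnj (cinner g f)"
  proof transfer
    fix f g :: "nat \<Rightarrow> 'a"
    assume "summable (\<lambda>n. (norm (f n))\<^sup>2)" "summable (\<lambda>n. (norm (g n))\<^sup>2)"
    then have "(\<lambda>n. cnj (cinner (g n) (f n))) sums cnj (\<Sum>n. cinner (g n) (f n))"
      by (intro sums_cnj[THEN iffD2] summable_sums summable_l2_cinner)
    then show "(\<Sum>n. cinner (f n) (g n)) = cnj (\<Sum>n. cinner (g n) (f n))"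
      by (subst cinner_commute) (rule sums_unique[symmetric])
  qed
  show "cinner (f + g) h = cinner f h + cinner g h"
    by transfer (simp add: cinner_add_left suminf_add summable_l2_cinner)
  show "cinner (a *\<^sub>C f) g = a * cinner f g"
    by transfer (simp add: cinner_scaleC_left suminf_mult summable_l2_cinner)
  show "Re (cinner f g) = inner f g"
    by transfer (simp add: Re_suminf summable_l2_cinner Re_cinner)
qed

end

lift_definition l2_embed :: "'a::real_normed_vector \<Rightarrow> 'a l2" is "\<lambda>h n. if n = 0 then h else 0"
  by (rule summable_finite[of "{0}"]) auto

definition has_block_matrix ::
  "('a::real_normed_vector l2 \<Rightarrow> 'a l2) \<Rightarrow> (nat \<Rightarrow> nat \<Rightarrow> 'a \<Rightarrow>\<^sub>L 'a) \<Rightarrow> bool" where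
  "has_block_matrix V M \<longleftrightarrow> (\<forall>x i. (\<lambda>j. M i j (l2_nth x j)) sums l2_nth (V x) i)"

end

theory Submission
  imports Defs
begin

text \<open>
  Let \<open>w\<close> be the given isometric dilation and \<open>J\<close> the embedding of \<open>\<H>\<close>. A Gram--Schmidt process
  along \<open>J, w J, w\<^sup>2 J, \<dots>\<close> yields isometries \<open>u\<^sub>0 = J, u\<^sub>1, u\<^sub>2, \<dots>\<close> of \<open>\<H>\<close> with mutually
  orthogonal ranges: the remainder of \<open>w u\<^sub>n\<close> after projecting away the ranges of \<open>u\<^sub>0, \<dots>, u\<^sub>n\<close> has
  Gram operator \<open>I - (\<Sum>i\<le>n. (V i n)\<^sup>* (V i n))\<close>, which is therefore positive, and the remainder
  factors as \<open>u\<^sub>n\<^sub>+\<^sub>1 V (n + 1) n\<close>. The recurrence computes exactly the compressions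
  \<open>V i j = u\<^sub>i\<^sup>* w u\<^sub>j\<close>. Hence \<open>V\<close> is \<open>w\<close>, restricted to the closed span of the ranges of the
  \<open>u\<^sub>i\<close> and written in the coordinates given by the \<open>u\<^sub>i\<close>. Minimality holds because \<open>V\<^sup>n\<close> maps the
  \<open>0\<close>-th summand to the summands \<open>0, \<dots>, n\<close>, with invertible last component.
\<close>

section \<open>Adjoints and positive square roots\<close>

lemma quadratic_nonneg_discriminant:
  fixes a b c :: real
  assumes "0 \<le> c" "\<And>t. 0 \<le> a + 2 * t * b + t\<^sup>2 * c"
  shows "b\<^sup>2 \<le> a * c"
proof (cases "c = 0")
  case True
  have "b = 0"
  proof (rule ccontr)
    assume "b \<noteq> 0"
    \<comment> \<open>For \<open>c = 0\<close> the expression is affine in \<open>t\<close>, and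
      this \<open>t\<close> gives it the value -1.\<close>
    then show False using assms(2)[of "- (a + 1) / (2 * b)"] True by (simp add: field_simps)
  qed
  then show ?thesis using True by simp
next
  case False
  have "0 \<le> c * (a + 2 * (- b / c) * b + (- b / c)\<^sup>2 * c)"
    by (intro mult_nonneg_nonneg assms)
  also have "\<dots> = a * c - b\<^sup>2" using False by (simp add: field_simps power2_eq_square)
  finally show ?thesis by simp
qed

text \<open>The representing vector minimises \<open>\<lambda>x. (norm x)\<^sup>2 - 2 * f x\<close>.\<close>

lemma riesz_representation:
  fixes f :: "'a::{real_inner, banach} \<Rightarrow> real"
  assumes "bounded_linear f"
  obtains z where "\<And>x. f x = inner x z"
proof -
  interpret f: bounded_linear f by fact
  define \<phi> where "\<phi> x = (norm x)\<^sup>2 - 2 * f x" for x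
  obtain K where K: "\<And>x. norm (f x) \<le> norm x * K" using f.bounded by blast
  have "- K\<^sup>2 \<le> \<phi> x" for x
  proof -
    have "0 \<le> (norm x - K)\<^sup>2" by simp
    moreover have "f x \<le> norm x * K" using K[of x] by simp
    ultimately show ?thesis by (simp add: \<phi>_def power2_diff)
  qed
  then have bdd: "bdd_below (range \<phi>)" by (intro bdd_belowI2)
  define m where "m = Inf (range \<phi>)"
  have m: "m \<le> \<phi> x" for x unfolding m_def using bdd by (simp add: cInf_lower)
  have "\<exists>x. \<phi> x < m + 1 / Suc n" for n
  proof -
    have "m < m + 1 / Suc n" by simp
    then show ?thesis unfolding m_def using cInf_lessD[of "range \<phi>"] by (metis UNIV_not_empty empty_is_image rangeE)
  qed
  then obtain x where x: "\<And>n. \<phi> (x n) < m + 1 / Suc n" by metis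
  \<comment> \<open>Parallelogram law: the midpoint of \<open>y\<close> and \<open>z\<close> has
    value at least \<open>m\<close>, so two near-minimisers are close to each other.\<close>
  have par: "(norm (y - z))\<^sup>2 \<le> 2 * \<phi> y + 2 * \<phi> z - 4 * m" for y z
  proof -
    have "(norm (y - z))\<^sup>2 + (norm (y + z))\<^sup>2 = 2 * (norm y)\<^sup>2 + 2 * (norm z)\<^sup>2"
      by (simp add: power2_norm_eq_inner inner_add_left inner_add_right inner_diff_left inner_diff_right)
    moreover have "4 * \<phi> ((1/2) *\<^sub>R (y + z)) = (norm (y + z))\<^sup>2 - 4 * f y - 4 * f z"
      unfolding \<phi>_def by (simp only: f.scaleR f.add norm_scaleR) (simp add: power_divide algebra_simps)
    ultimately show ?thesis using m[of "(1/2) *\<^sub>R (y + z)"] unfolding \<phi>_def by simp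
  qed
  have "Cauchy x"
  proof (rule metric_CauchyI)
    fix e :: real assume "0 < e"
    then obtain N where N: "inverse (Suc N) < e\<^sup>2 / 4"
      using reals_Archimedean[of "e\<^sup>2 / 4"] by auto
    have "dist (x i) (x j) < e" if "N \<le> i" "N \<le> j" for i j
    proof -
      have "1 / Suc i \<le> inverse (Suc N)" "1 / Suc j \<le> inverse (Suc N)"
        using that by (auto simp: field_simps)
      then have "(norm (x i - x j))\<^sup>2 < e\<^sup>2"
        using par[of "x i" "x j"] x[of i] x[of j] N by linarith
      then show ?thesis using \<open>0 < e\<close> by (simp add: dist_norm power2_less_imp_less)
    qed
    then show "\<exists>M. \<forall>m\<ge>M. \<forall>n\<ge>M. dist (x m) (x n) < e" by blast
  qed
  then obtain z where z: "x \<longlonglongrightarrow> z" using Cauchy_convergent_iff convergent_def by blast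
  have "(\<lambda>n. \<phi> (x n)) \<longlonglongrightarrow> \<phi> z"
    unfolding \<phi>_def by (intro tendsto_intros z f.tendsto)
  moreover have "(\<lambda>n. m + 1 / Suc n) \<longlonglongrightarrow> m + 0"
    by (intro tendsto_intros LIMSEQ_Suc[OF lim_1_over_n])
  ultimately have "\<phi> z \<le> m + 0"
    using x by (intro LIMSEQ_le) (auto intro!: exI[of _ 0] less_imp_le)
  then have min: "\<phi> z \<le> \<phi> y" for y using m[of y] by simp
  have "f y = inner y z" for y
  proof -
    \<comment> \<open>First-order condition at the minimum \<open>z\<close>: with constant term 0,
      the discriminant bound makes the linear coefficient vanish.\<close>
    have "0 \<le> 0 + 2 * t * (inner y z - f y) + t\<^sup>2 * (norm y)\<^sup>2" for t
      using min[of "z + t *\<^sub>R y"]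
      unfolding \<phi>_def f.add f.scaleR power2_norm_eq_inner
      by (simp add: inner_add_left inner_add_right inner_commute algebra_simps power2_eq_square)
    from quadratic_nonneg_discriminant[OF zero_le_power2 this] show ?thesis by simp
  qed
  then show thesis by (rule that)
qed

text \<open>Unlike \<open>op_adjoint\<close>, this covers maps between different spaces, such as the
  embedding \<open>J\<close>. On complex linear endomorphisms the two agree by
  \<open>op_adjoint_eq\<close>.\<close>

definition blinfun_adjoint ::
  "'a::{real_inner, banach} \<Rightarrow>\<^sub>L 'b::real_inner \<Rightarrow> 'b \<Rightarrow>\<^sub>L 'a" where
  "blinfun_adjoint T = Blinfun (adjoint T)"

lemma inner_eqI: "(\<And>z. inner z x = inner z y) \<Longrightarrow> x = (y :: 'a::real_inner)"
  by (metis inner_eq_zero_iff inner_diff_right right_minus_eq)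

lemma inner_adjoint_right:
  fixes T :: "'a::{real_inner, banach} \<Rightarrow>\<^sub>L 'b::real_inner"
  shows "inner x (blinfun_adjoint T y) = inner (T x) y"
proof -
  have "\<exists>z. \<forall>x. inner (T x) y = inner x z" for y
    by (rule riesz_representation[OF bounded_linear_compose[OF bounded_linear_inner_left
          blinfun.bounded_linear_right[of T]], of y]) blast
  then have "\<exists>S. \<forall>x y. inner (T x) y = inner x (S y)" by metis
  then have adj: "\<And>x y. inner (T x) y = inner x (adjoint T y)"
    unfolding adjoint_def by (rule someI2_ex) blast
  have "bounded_linear (adjoint T)"
  proof (rule bounded_linear_intro[where K = "norm T"])
    show "adjoint T (x + y) = adjoint T x + adjoint T y" for x y
      by (rule inner_eqI) (simp add: adj[symmetric] inner_add_right)
    show "adjoint T (r *\<^sub>R x) = r *\<^sub>R adjoint T x" for r x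
      by (rule inner_eqI) (simp add: adj[symmetric])
    fix x
    have "norm (adjoint T x) * norm (adjoint T x) = inner (T (adjoint T x)) x"
      by (simp add: adj norm_eq_sqrt_inner)
    also have "\<dots> \<le> norm (T (adjoint T x)) * norm x" by (rule norm_cauchy_schwarz)
    also have "\<dots> \<le> (norm T * norm (adjoint T x)) * norm x"
      by (intro mult_right_mono norm_blinfun) simp
    finally have "norm (adjoint T x) * norm (adjoint T x) \<le> norm (adjoint T x) * (norm x * norm T)"
      by (simp add: mult_ac)
    then show "norm (adjoint T x) \<le> norm x * norm T"
      by (cases "norm (adjoint T x) = 0") (simp_all add: mult_le_cancel_left)
  qed
  then show ?thesis by (simp add: blinfun_adjoint_def bounded_linear_Blinfun_apply adj)
qed

lemma inner_adjoint_left: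
  fixes T :: "'a::{real_inner, banach} \<Rightarrow>\<^sub>L 'b::real_inner"
  shows "inner (blinfun_adjoint T y) x = inner y (T x)"
  by (metis inner_adjoint_right inner_commute)

section \<open>Positive operators over the reals, where symmetry has to be required
  separately\<close>

definition real_positive :: "'a::real_inner \<Rightarrow>\<^sub>L 'a \<Rightarrow> bool" where
  "real_positive T \<longleftrightarrow> (\<forall>x y. inner (T x) y = inner x (T y)) \<and> (\<forall>x. 0 \<le> inner (T x) x)"

text \<open>Along the line through \<open>x\<close> in direction \<open>y\<close>, the form of
  \<open>T\<close> is a nonnegative quadratic polynomial in the real parameter.\<close>

lemma real_positive_Cauchy_Schwarz:
  fixes T :: "'a::real_inner \<Rightarrow>\<^sub>L 'a"
  assumes "real_positive T"
  shows "(inner (T x) y)\<^sup>2 \<le> inner (T x) x * inner (T y) y"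
proof (rule quadratic_nonneg_discriminant)
  show "0 \<le> inner (T y) y" using assms unfolding real_positive_def by blast
  fix t
  have sym: "inner (T y) x = inner (T x) y"
    using assms by (metis real_positive_def inner_commute)
  have "0 \<le> inner (T (x + t *\<^sub>R y)) (x + t *\<^sub>R y)"
    using assms unfolding real_positive_def by blast
  then show "0 \<le> inner (T x) x + 2 * t * inner (T x) y + t\<^sup>2 * inner (T y) y"
    by (simp add: blinfun.bilinear_simps inner_add_left inner_add_right sym algebra_simps power2_eq_square)
qed

lemma real_positive_eq_0:
  assumes "real_positive T" "inner (T x) x = 0"
  shows "T x = 0"
  using real_positive_Cauchy_Schwarz[OF assms(1), of x "T x"] assms(2) by simp

text \<open>Cauchy-Schwarz for the form of \<open>T\<close>, at \<open>x\<close> and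
  \<open>T x\<close>, bounds the fourth power of \<open>norm (T x)\<close> by the product of the
  squares of \<open>norm x\<close> and \<open>norm (T x)\<close>.\<close>

lemma real_positive_norm_le_1:
  assumes "real_positive T" "\<And>x. inner (T x) x \<le> inner x x"
  shows "norm T \<le> 1"
proof (rule norm_blinfun_bound)
  fix x
  have "((norm (T x))\<^sup>2)\<^sup>2 \<le> inner (T x) x * inner (T (T x)) (T x)"
    using real_positive_Cauchy_Schwarz[OF assms(1), of x "T x"] by (simp add: power2_norm_eq_inner)
  also have "\<dots> \<le> (norm x)\<^sup>2 * (norm (T x))\<^sup>2"
    unfolding power2_norm_eq_inner
  proof (intro mult_mono assms(2))
    show "0 \<le> inner (T (T x)) (T x)" using assms(1) unfolding real_positive_def by blast
  qed simp
  finally have "(norm (T x))\<^sup>2 * (norm (T x))\<^sup>2 \<le> (norm x)\<^sup>2 * (norm (T x))\<^sup>2"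
    by (simp add: power2_eq_square)
  then have "T x = 0 \<or> (norm (T x))\<^sup>2 \<le> (norm x)\<^sup>2"
    by (metis mult_le_cancel_right norm_eq_zero not_less zero_le_power2 power2_eq_iff_nonneg
        order_le_less zero_eq_power2)
  then show "norm (T x) \<le> 1 * norm x"
    by (auto dest: power2_le_imp_le)
qed simp

text \<open>\<open>I - L\<close> is a square root of \<open>I - B\<close> iff \<open>L = (B + L\<^sup>2) / 2\<close>; the fixed point iteration is
  dominated in norm by the same iteration for the number \<open>1\<close>.\<close>

fun sqrt_iter :: "'a::real_normed_vector \<Rightarrow>\<^sub>L 'a \<Rightarrow> nat \<Rightarrow> 'a \<Rightarrow>\<^sub>L 'a" where
  "sqrt_iter B 0 = 0"
| "sqrt_iter B (Suc n) = (1/2) *\<^sub>R (B + (sqrt_iter B n o\<^sub>L sqrt_iter B n))"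

text \<open>Each iterate is a polynomial in \<open>B\<close>. Taking an iterate for \<open>C\<close>
  shows that the iterates commute with one another.\<close>

lemma sqrt_iter_commute:
  assumes "C o\<^sub>L B = B o\<^sub>L C"
  shows "C o\<^sub>L sqrt_iter B n = sqrt_iter B n o\<^sub>L C"
proof (induction n)
  case (Suc n)
  have c: "C (B x) = B (C x)" for x using assms by (metis blinfun_apply_blinfun_compose)
  have "C (sqrt_iter B n x) = sqrt_iter B n (C x)" for x using Suc by (metis blinfun_apply_blinfun_compose)
  then show ?case by (intro blinfun_eqI) (simp add: blinfun.bilinear_simps c)
qed simp

fun sqrt_bound :: "nat \<Rightarrow> real" where
  "sqrt_bound 0 = 0"
| "sqrt_bound (Suc n) = (1 + (sqrt_bound n)\<^sup>2) / 2"

lemma sqrt_bound_nonneg: "0 \<le> sqrt_bound n"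
  by (induction n) auto

lemma sqrt_bound_le_1: "sqrt_bound n \<le> 1"
  by (induction n) (auto simp: sqrt_bound_nonneg power_le_one)

lemma sqrt_bound_Suc_le: "sqrt_bound n \<le> sqrt_bound (Suc n)"
  using sum_squares_bound[of 1 "sqrt_bound n"] by simp

lemma norm_sqrt_iter_le:
  assumes "norm B \<le> 1"
  shows "norm (sqrt_iter B n) \<le> sqrt_bound n"
proof (induction n)
  case (Suc n)
  have "norm (sqrt_iter B n o\<^sub>L sqrt_iter B n) \<le> norm (sqrt_iter B n) * norm (sqrt_iter B n)"
    by (rule norm_blinfun_compose)
  also have "\<dots> \<le> (sqrt_bound n)\<^sup>2"
    unfolding power2_eq_square by (intro mult_mono Suc) (auto simp: sqrt_bound_nonneg)
  finally have "norm (B + (sqrt_iter B n o\<^sub>L sqrt_iter B n)) \<le> 1 + (sqrt_bound n)\<^sup>2"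
    using assms by (intro norm_triangle_le) simp
  then show ?case by simp
qed simp

text \<open>Consecutive iterates commute, so the difference of their squares factors into difference
  and sum; each factor is dominated by its scalar counterpart.\<close>

lemma norm_sqrt_iter_diff_le:
  assumes "norm B \<le> 1"
  shows "norm (sqrt_iter B (Suc n) - sqrt_iter B n) \<le> sqrt_bound (Suc n) - sqrt_bound n"
proof (induction n)
  case 0
  then show ?case using assms by simp
next
  case (Suc n)
  let ?Y = "sqrt_iter B"
  have "?Y (Suc n) o\<^sub>L ?Y n = ?Y n o\<^sub>L ?Y (Suc n)"
    by (intro sqrt_iter_commute sqrt_iter_commute[symmetric]) simp
  then have c: "?Y (Suc n) (?Y n x) = ?Y n (?Y (Suc n) x)" for x
    by (metis blinfun_apply_blinfun_compose)
  have "?Y (Suc (Suc n)) - ?Y (Suc n) =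
      (1/2) *\<^sub>R ((?Y (Suc n) - ?Y n) o\<^sub>L (?Y (Suc n) + ?Y n))"
    \<comment> \<open>The \<open>arg_cong\<close> instance unfolds \<open>?Y (Suc n)\<close> only as
      a subtrahend; its other occurrences stay folded for the factorisation.\<close>
    unfolding sqrt_iter.simps(2)[of B "Suc n"] sqrt_iter.simps(2)[of B n, THEN arg_cong, of "\<lambda>y. _ - y"]
    by (intro blinfun_eqI)
       (simp del: sqrt_iter.simps(2) add: blinfun.bilinear_simps c algebra_simps)
  also have "norm \<dots> \<le> (1/2) * (norm (?Y (Suc n) - ?Y n) * norm (?Y (Suc n) + ?Y n))"
    by (simp del: sqrt_iter.simps(2) add: norm_blinfun_compose)
  also have "\<dots> \<le> (1/2) * ((sqrt_bound (Suc n) - sqrt_bound n) * (sqrt_bound (Suc n) + sqrt_bound n))"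
    by (intro mult_left_mono mult_mono Suc norm_triangle_le add_mono norm_sqrt_iter_le assms)
       (use sqrt_bound_Suc_le[of n] in auto)
  also have "\<dots> = sqrt_bound (Suc (Suc n)) - sqrt_bound (Suc n)"
    by (simp only: sqrt_bound.simps(2)[of "Suc n"] sqrt_bound.simps(2)[of n, THEN arg_cong, of "\<lambda>y. _ - y"])
       (simp add: power2_eq_square field_simps)
  finally show ?case .
qed

text \<open>The root is \<open>id_blinfun - L\<close>, with \<open>L\<close> the limit of the
  iteration for \<open>id_blinfun - T\<close>. The commutation property later yields uniqueness and
  complex linearity of the root.\<close>

lemma positive_sqrt_exists:
  fixes T :: "'a::{real_inner, banach} \<Rightarrow>\<^sub>L 'a"
  assumes "real_positive T" "\<And>x. inner (T x) x \<le> inner x x"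
  obtains R where "real_positive R" "R o\<^sub>L R = T"
    "\<And>C. C o\<^sub>L T = T o\<^sub>L C \<Longrightarrow> C o\<^sub>L R = R o\<^sub>L C"
proof -
  define B where "B = id_blinfun - T"
  let ?Y = "sqrt_iter B"
  have sT: "inner (T x) y = inner x (T y)" for x y using assms(1) by (simp add: real_positive_def)
  have "real_positive B"
    using assms sT by (simp add: real_positive_def B_def blinfun.bilinear_simps inner_diff_left inner_diff_right)
  moreover have "inner (B x) x \<le> inner x x" for x
  proof -
    have "0 \<le> inner (T x) x" using assms(1) unfolding real_positive_def by blast
    then show ?thesis by (simp add: B_def blinfun.bilinear_simps inner_diff_left)
  qed
  ultimately have nB: "norm B \<le> 1" by (rule real_positive_norm_le_1)
  \<comment> \<open>The increments of the iteration are dominated by a telescoping series of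
    numbers, convergent because \<open>sqrt_bound\<close> is increasing and bounded by 1.\<close>
  have "incseq sqrt_bound" by (intro incseq_SucI sqrt_bound_Suc_le)
  then obtain l where "sqrt_bound \<longlonglongrightarrow> l"
    using incseq_convergent[of sqrt_bound 1] sqrt_bound_le_1 by blast
  then have "summable (\<lambda>n. sqrt_bound (Suc n) - sqrt_bound n)" by (rule telescope_summable)
  then have "summable (\<lambda>n. ?Y (Suc n) - ?Y n)"
    by (rule summable_comparison_test[rotated]) (use norm_sqrt_iter_diff_le[OF nB] in blast)
  from summable_LIMSEQ[OF this] obtain L where L: "?Y \<longlonglongrightarrow> L"
    unfolding sum_lessThan_telescope by auto
  have Lx: "(\<lambda>n. ?Y n x) \<longlonglongrightarrow> L x" for x
    by (intro blinfun.tendsto L tendsto_const)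
  have nL: "norm L \<le> 1"
    by (rule LIMSEQ_le_const2[OF tendsto_norm[OF L]])
       (meson norm_sqrt_iter_le nB sqrt_bound_le_1 order_trans)
  have fix_L: "L = (1/2) *\<^sub>R (B + (L o\<^sub>L L))"
  proof (rule LIMSEQ_unique)
    show "(\<lambda>n. ?Y (Suc n)) \<longlonglongrightarrow> L" using L by (rule LIMSEQ_Suc)
    show "(\<lambda>n. ?Y (Suc n)) \<longlonglongrightarrow> (1/2) *\<^sub>R (B + (L o\<^sub>L L))"
      unfolding sqrt_iter.simps
      by (intro tendsto_intros L bounded_bilinear.tendsto[OF bounded_bilinear_blinfun_compose])
  qed
  have sB: "inner (B x) y = inner x (B y)" for x y
    using sT by (simp add: B_def blinfun.bilinear_simps inner_diff_left inner_diff_right)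
  have sY: "inner (?Y n x) y = inner x (?Y n y)" for n x y
    by (induction n arbitrary: x y)
       (simp_all add: blinfun.bilinear_simps inner_add_left inner_add_right sB)
  have sL: "inner (L x) y = inner x (L y)" for x y
    by (rule LIMSEQ_unique[OF tendsto_inner[OF Lx tendsto_const]])
       (unfold sY, intro tendsto_inner Lx tendsto_const)
  let ?R = "id_blinfun - L"
  show thesis
  proof (rule that[of ?R])
    \<comment> \<open>Positivity of \<open>id_blinfun - L\<close> comes from
      \<open>norm L \<le> 1\<close>.\<close>
    have "inner (L x) x \<le> inner x x" for x
    proof -
      have "inner (L x) x \<le> norm (L x) * norm x" by (rule norm_cauchy_schwarz)
      also have "\<dots> \<le> (norm L * norm x) * norm x" by (intro mult_right_mono norm_blinfun) simp
      also have "\<dots> \<le> (1 * norm x) * norm x" by (intro mult_right_mono nL) auto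
      finally show ?thesis by (simp add: norm_eq_sqrt_inner)
    qed
    then show "real_positive ?R"
      by (simp add: real_positive_def blinfun.bilinear_simps inner_diff_left inner_diff_right sL)
    show "?R o\<^sub>L ?R = T"
    proof (rule blinfun_eqI)
      fix x
      have "2 *\<^sub>R L x = x - T x + L (L x)"
        by (subst fix_L) (simp add: blinfun.bilinear_simps B_def)
      then show "(?R o\<^sub>L ?R) x = T x"
        by (simp add: blinfun.bilinear_simps algebra_simps scaleR_2)
    qed
    fix C :: "'a \<Rightarrow>\<^sub>L 'a"
    assume "C o\<^sub>L T = T o\<^sub>L C"
    then have "C (T x) = T (C x)" for x by (metis blinfun_apply_blinfun_compose)
    then have "C o\<^sub>L B = B o\<^sub>L C"
      by (intro blinfun_eqI) (simp add: B_def blinfun.bilinear_simps)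
    from sqrt_iter_commute[OF this] have "C o\<^sub>L L = L o\<^sub>L C"
      by (intro LIMSEQ_unique[OF bounded_bilinear.tendsto[OF bounded_bilinear_blinfun_compose tendsto_const L]])
         (auto intro!: bounded_bilinear.tendsto[OF bounded_bilinear_blinfun_compose] L)
    then have "C (L x) = L (C x)" for x by (metis blinfun_apply_blinfun_compose)
    then show "C o\<^sub>L ?R = ?R o\<^sub>L C"
      by (intro blinfun_eqI) (simp add: blinfun.bilinear_simps)
  qed
qed

text \<open>For commuting roots, \<open>R + S\<close> annihilates \<open>y = R x - S x\<close>. Both
  nonnegative forms therefore vanish at \<open>y\<close>, which gives \<open>R y = S y = 0\<close>,
  and then \<open>inner y y = inner x (R y - S y) = 0\<close>.\<close>

lemma positive_sqrt_unique:
  fixes R S :: "'a::real_inner \<Rightarrow>\<^sub>L 'a"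
  assumes R: "real_positive R" and S: "real_positive S"
    and eq: "R o\<^sub>L R = S o\<^sub>L S" and comm: "R o\<^sub>L S = S o\<^sub>L R"
  shows "R = S"
proof (rule blinfun_eqI)
  fix x
  have e: "R (R x) = S (S x)" "R (S x) = S (R x)" for x
    using eq comm by (metis blinfun_apply_blinfun_compose)+
  define y where "y = R x - S x"
  have "R y + S y = 0" by (simp add: y_def blinfun.bilinear_simps e)
  then have "inner (R y) y + inner (S y) y = 0" by (metis inner_add_left inner_zero_left)
  then have "inner (R y) y = 0" "inner (S y) y = 0"
    using R S by (smt (verit) real_positive_def)+
  then have "R y = 0" "S y = 0" using R S by (auto intro: real_positive_eq_0)
  moreover have "inner y y = inner x (R y) - inner x (S y)"
    using R S by (metis (no_types, lifting) real_positive_def inner_diff_left y_def)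
  ultimately show "R x = S x" by (simp add: y_def)
qed

section \<open>Complex linear operators\<close>

instance complex_hilbert \<subseteq> banach ..

text \<open>Reduces complex identities to the real theory: the second argument is conjugate linear,
  so multiplying it by \<open>\<i>\<close> turns the imaginary part into a real part.\<close>

lemma cinner_eq_Complex: "cinner x y = Complex (inner x y) (inner x (\<i> *\<^sub>C y))"
proof -
  have "cinner x (\<i> *\<^sub>C y) = cnj (\<i> * cinner y x)"
    by (metis cinner_commute cinner_scaleC_left)
  also have "\<dots> = - \<i> * cinner x y" by (simp add: cinner_commute[of x y])
  finally have "cinner x (\<i> *\<^sub>C y) = - \<i> * cinner x y" .
  then have "Im (cinner x y) = Re (cinner x (\<i> *\<^sub>C y))" by simp
  then show ?thesis by (simp add: complex_eq_iff Re_cinner)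
qed

lemma inner_scaleC_left: "inner (c *\<^sub>C x) y = inner x (cnj c *\<^sub>C y)"
proof -
  have "cinner (c *\<^sub>C x) y = cinner x (cnj c *\<^sub>C y)"
    by (metis cinner_commute cinner_scaleC_left complex_cnj_cnj complex_cnj_mult)
  then show ?thesis by (metis Re_cinner)
qed

lemma clinear_iff:
  "clinear f \<longleftrightarrow> (\<forall>x y. f (x + y) = f x + f y) \<and> (\<forall>c x. f (c *\<^sub>C x) = c *\<^sub>C f x)"
  by (simp add: Vector_Spaces.linear_iff complex_vector.vector_space_axioms)

lemma clinear_blinfun_iff: "clinear (blinfun_apply T) \<longleftrightarrow> (\<forall>c x. T (c *\<^sub>C x) = c *\<^sub>C T x)"
  by (simp add: clinear_iff blinfun.bilinear_simps)

lemma clinear_scaleC: "clinear f \<Longrightarrow> f (c *\<^sub>C x) = c *\<^sub>C f x"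
  by (simp add: clinear_iff)

lemma bounded_linear_scaleC: "bounded_linear (\<lambda>x :: 'a::complex_hilbert. c *\<^sub>C x)"
  by (rule bounded_linear_intro[where K = "cmod c"])
     (simp_all add: scaleC_add_right norm_scaleC scaleR_scaleC scaleC_scaleC mult.commute)

lemma clinear_isometry_bounded:
  assumes "clinear_isometry f"
  shows "bounded_linear f"
  using assms
  by (intro bounded_linear_intro[where K = 1])
     (simp_all add: clinear_isometry_def clinear_iff scaleR_scaleC)

lemma isometry_inner:
  fixes T :: "'a::real_inner \<Rightarrow>\<^sub>L 'b::real_inner"
  assumes "\<And>x. norm (T x) = norm x"
  shows "inner (T x) (T y) = inner x y"
proof -
  have "(norm (T (x + y)))\<^sup>2 = (norm (x + y))\<^sup>2" "(norm (T x))\<^sup>2 = (norm x)\<^sup>2" "(norm (T y))\<^sup>2 = (norm y)\<^sup>2"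
    by (simp_all add: assms)
  then show ?thesis
    by (simp add: blinfun.bilinear_simps power2_norm_eq_inner inner_add_left inner_add_right inner_commute)
qed

lemma clinear_compose:
  "clinear (blinfun_apply S) \<Longrightarrow> clinear (blinfun_apply T) \<Longrightarrow> clinear (blinfun_apply (S o\<^sub>L T))"
  unfolding clinear_blinfun_iff by (metis blinfun_apply_blinfun_compose)

lemma clinear_adjoint:
  fixes T :: "'a::complex_hilbert \<Rightarrow>\<^sub>L 'b::complex_hilbert"
  assumes "clinear T"
  shows "clinear (blinfun_adjoint T)"
  unfolding clinear_blinfun_iff
proof ((rule allI)+, rule inner_eqI)
  fix c x z
  have "inner z (blinfun_adjoint T (c *\<^sub>C x)) = inner (T (cnj c *\<^sub>C z)) x"
    by (simp add: inner_adjoint_right clinear_scaleC[OF assms] inner_scaleC_left)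
  also have "\<dots> = inner z (c *\<^sub>C blinfun_adjoint T x)"
    by (simp add: inner_adjoint_right[symmetric] inner_scaleC_left)
  finally show "inner z (blinfun_adjoint T (c *\<^sub>C x)) = inner z (c *\<^sub>C blinfun_adjoint T x)" .
qed

text \<open>The real adjoint is complex linear by \<open>clinear_adjoint\<close>, so its defining
  identity extends to imaginary parts; uniqueness follows from real parts alone.\<close>

lemma op_adjoint_eq:
  fixes T :: "'a::complex_hilbert \<Rightarrow>\<^sub>L 'a"
  assumes "clinear T"
  shows "op_adjoint T = blinfun_adjoint T"
  unfolding op_adjoint_def
proof (rule the_equality)
  show "\<forall>x y. cinner (T x) y = cinner x (blinfun_adjoint T y)"
    by (simp add: cinner_eq_Complex inner_adjoint_right
        clinear_scaleC[OF clinear_adjoint[OF assms], symmetric])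
  fix S :: "'a \<Rightarrow>\<^sub>L 'a"
  assume S: "\<forall>x y. cinner (T x) y = cinner x (S y)"
  show "S = blinfun_adjoint T"
    by (rule blinfun_eqI, rule inner_eqI) (metis S Re_cinner inner_adjoint_right)
qed

lemma adjoint_real_positive: "real_positive T \<Longrightarrow> blinfun_adjoint T = T"
  by (rule blinfun_eqI, rule inner_eqI) (simp add: inner_adjoint_right real_positive_def)

text \<open>A real-valued complex quadratic form forces symmetry: polarise the vanishing imaginary
  part, then replace \<open>y\<close> by \<open>\<i> *\<^sub>C y\<close>. Conversely, symmetry makes
  the imaginary part equal to its own negative.\<close>

lemma op_positive_iff: "op_positive T \<longleftrightarrow> clinear T \<and> real_positive T"
proof safe
  assume T: "op_positive T"
  then show cl: "clinear T" by (simp add: op_positive_def)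
  let ?J = "\<lambda>x. \<i> *\<^sub>C x"
  have im: "inner (T x) (?J x) = 0" for x
  proof -
    have "Im (cinner (T x) x) = 0" using T by (auto simp: op_positive_def complex_is_Real_iff)
    then show ?thesis by (simp add: cinner_eq_Complex)
  qed
  have *: "inner (T x) (?J y) + inner (T y) (?J x) = 0" for x y
    using im[of "x + y"] im[of x] im[of y]
    by (simp add: blinfun.bilinear_simps scaleC_add_right inner_add_left inner_add_right)
  have "inner (T x) y = inner x (T y)" for x y
  proof -
    have "?J (?J y) = - y" by (simp add: scaleC_scaleC scaleR_scaleC[of "-1", simplified])
    moreover have "inner (T (?J y)) (?J x) = inner (T y) x"
      by (simp add: clinear_scaleC[OF cl] inner_scaleC_left scaleC_scaleC scaleC_one)
    ultimately show ?thesis using *[of x "?J y"] by (simp add: inner_commute)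
  qed
  moreover have "0 \<le> inner (T x) x" for x
    using T by (simp add: op_positive_def Re_cinner)
  ultimately show "real_positive T" by (simp add: real_positive_def)
next
  assume cl: "clinear T" and T: "real_positive T"
  have sym: "inner (T x) y = inner x (T y)" for x y using T by (simp add: real_positive_def)
  have "inner (T x) (\<i> *\<^sub>C x) = 0" for x
  proof -
    have "inner (T x) (\<i> *\<^sub>C x) = inner x (\<i> *\<^sub>C T x)"
      by (simp add: sym clinear_scaleC[OF cl])
    also have "\<dots> = inner (cnj \<i> *\<^sub>C x) (T x)" by (simp add: inner_scaleC_left)
    also have "\<dots> = - inner (\<i> *\<^sub>C x) (T x)"
      by (metis complex_cnj_i complex_vector.scale_minus_left inner_minus_left)
    finally show ?thesis by (simp add: inner_commute)
  qed
  moreover have "0 \<le> inner (T x) x" for x using T by (auto simp: real_positive_def)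
  ultimately show "op_positive T"
    using cl by (simp add: op_positive_def cinner_eq_Complex complex_is_Real_iff)
qed

lemma op_sqrt_props:
  assumes "op_positive T" "\<And>x. inner (T x) x \<le> inner x x"
  shows "op_positive (op_sqrt T)" "op_sqrt T o\<^sub>L op_sqrt T = T"
proof -
  have T: "clinear T" "real_positive T" using assms(1) by (auto simp: op_positive_iff)
  from positive_sqrt_exists[OF T(2) assms(2)] obtain R where
    R: "real_positive R" "R o\<^sub>L R = T" and comm: "\<And>C. C o\<^sub>L T = T o\<^sub>L C \<Longrightarrow> C o\<^sub>L R = R o\<^sub>L C"
    by metis
  \<comment> \<open>Multiplication by \<open>c\<close> is a bounded operator commuting with the
    complex linear \<open>T\<close>, hence with \<open>R\<close>.\<close>
  have "R (c *\<^sub>C x) = c *\<^sub>C R x" for c x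
  proof -
    let ?C = "Blinfun (\<lambda>x. c *\<^sub>C x)"
    have C: "?C x = c *\<^sub>C x" for x
      by (simp add: bounded_linear_Blinfun_apply bounded_linear_scaleC)
    have "?C o\<^sub>L T = T o\<^sub>L ?C"
      by (rule blinfun_eqI) (simp add: C clinear_scaleC[OF T(1)])
    from comm[OF this] show ?thesis by (metis C blinfun_apply_blinfun_compose)
  qed
  then have "op_positive R" using R by (simp add: op_positive_iff clinear_blinfun_iff)
  moreover have "S = R" if "op_positive S" "S o\<^sub>L S = T" for S
  proof (rule positive_sqrt_unique)
    \<comment> \<open>\<open>S\<close> commutes with its own square \<open>T\<close>, hence with
      \<open>R\<close>.\<close>
    have "S o\<^sub>L T = T o\<^sub>L S"
      unfolding that(2)[symmetric] by (rule blinfun_eqI) simp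
    then show "S o\<^sub>L R = R o\<^sub>L S" by (rule comm)
  qed (use that R in \<open>simp_all add: op_positive_iff\<close>)
  ultimately have "op_sqrt T = R"
    unfolding op_sqrt_def using R(2) by (rule_tac the_equality) blast+
  then show "op_positive (op_sqrt T)" "op_sqrt T o\<^sub>L op_sqrt T = T"
    using \<open>op_positive R\<close> R(2) by simp_all
qed

lemma is_op_inverse_op_inverse:
  assumes "op_invertible T"
  shows "is_op_inverse T (op_inverse T)"
proof -
  obtain S where S: "is_op_inverse T S" using assms by (auto simp: op_invertible_def)
  have "S' = S" if "is_op_inverse T S'" for S'
  proof (rule blinfun_eqI)
    fix x
    have "S' (T (S x)) = S x" "T (S x) = x"
      using that S by (metis is_op_inverse_def blinfun_apply_blinfun_compose blinfun_apply_id_blinfun id_apply)+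
    then show "S' x = S x" by simp
  qed
  then show ?thesis unfolding op_inverse_def using S by (rule_tac theI)
qed

lemma op_inverse_left [simp]: "op_invertible T \<Longrightarrow> op_inverse T (T x) = x"
  and op_inverse_right [simp]: "op_invertible T \<Longrightarrow> T (op_inverse T x) = x"
  using is_op_inverse_op_inverse
  by (metis is_op_inverse_def blinfun_apply_blinfun_compose blinfun_apply_id_blinfun id_apply)+

lemma clinear_op_inverse:
  fixes T :: "'a::complex_hilbert \<Rightarrow>\<^sub>L 'a"
  assumes "op_invertible T" "clinear T"
  shows "clinear (op_inverse T)"
  unfolding clinear_blinfun_iff
  by (metis assms op_inverse_left op_inverse_right clinear_scaleC)

text \<open>The adjoint is a left inverse of the isometry \<open>T\<close>, so the residual of
  \<open>y\<close> is orthogonal to the range for the real inner product. The range is closed under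
  multiplication by \<open>\<i>\<close>, so this is complex orthogonality.\<close>

lemma orth_proj_range:
  fixes T :: "'a::complex_hilbert \<Rightarrow>\<^sub>L 'b::complex_hilbert"
  assumes cl: "clinear T" and iso: "\<And>x. norm (T x) = norm x"
  shows "orth_proj (range T) y = T (blinfun_adjoint T y)"
  unfolding orth_proj_def
proof (rule the_equality)
  have "inner (y - T (blinfun_adjoint T y)) (T x) = 0" for x
    by (simp add: inner_diff_left isometry_inner[OF iso] inner_adjoint_left)
  then show "T (blinfun_adjoint T y) \<in> range T \<and>
      (\<forall>z\<in>range T. cinner (y - T (blinfun_adjoint T y)) z = 0)"
    by (auto simp: cinner_eq_Complex complex_eq_iff clinear_scaleC[OF cl, symmetric])
  fix z
  assume "z \<in> range T \<and> (\<forall>v\<in>range T. cinner (y - z) v = 0)"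
  then obtain x where z: "z = T x" and "\<And>v. cinner (y - T x) (T v) = 0" by auto
  then have "inner (y - T x) (T v) = 0" for v by (metis Re_cinner zero_complex.simps(1))
  then have *: "inner (T v) y = inner v x" for v
    by (metis inner_diff_left inner_commute isometry_inner[OF iso] right_minus_eq)
  have "blinfun_adjoint T y = x"
    by (rule inner_eqI) (simp add: inner_adjoint_right *)
  then show "z = T (blinfun_adjoint T y)" by (simp add: z)
qed

section \<open>Orthogonal embeddings and coordinates\<close>

lift_definition l2_single :: "nat \<Rightarrow> 'a::real_normed_vector \<Rightarrow> 'a l2"
  is "\<lambda>k h n. if n = k then h else 0"
proof -
  fix k :: nat and h :: 'a
  show "summable (\<lambda>n. (norm (if n = k then h else 0))\<^sup>2)"
    by (rule summable_finite[of "{k}"]) auto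
qed

lemma l2_embed_eq_single: "l2_embed = l2_single 0"
  by (rule ext) (transfer, simp)

lemma l2_nth_sum: "l2_nth (sum f S) n = (\<Sum>i\<in>S. l2_nth (f i) n)"
  by (induction S rule: infinite_finite_induct) (simp_all add: zero_l2.rep_eq plus_l2.rep_eq)

lemma inner_l2_single: "inner x (l2_single n h) = inner (l2_nth x n) h"
proof transfer
  fix x :: "nat \<Rightarrow> 'a" and n h
  have "(\<Sum>i. inner (x i) (if i = n then h else 0)) = (\<Sum>i\<in>{n}. inner (x i) (if i = n then h else 0))"
    by (rule suminf_finite) auto
  then show "(\<Sum>i. inner (x i) (if i = n then h else 0)) = inner (x n) h" by simp
qed

text \<open>The squared distance from \<open>x\<close> to a partial sum is the tail of its norm
  series.\<close>

lemma l2_single_sums: "(\<lambda>n. l2_single n (l2_nth x n)) sums (x :: 'a::real_inner l2)"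
proof -
  define a where "a n = (norm (l2_nth x n))\<^sup>2" for n
  have a: "summable a" unfolding a_def by (rule summable_l2_nth)
  have "(norm (x - (\<Sum>n<N. l2_single n (l2_nth x n))))\<^sup>2 = suminf a - (\<Sum>n<N. a n)" for N
  proof -
    have "(norm (l2_nth (x - (\<Sum>n<N. l2_single n (l2_nth x n))) k))\<^sup>2 = a k - (if k < N then a k else 0)" for k
      by (simp add: minus_l2.rep_eq l2_nth_sum l2_single.rep_eq a_def)
    moreover have "(\<lambda>k. if k < N then a k else 0) sums (\<Sum>n<N. a n)"
      using sums_If_finite_set[of "{..<N}" a] by simp
    ultimately show ?thesis
      unfolding norm_l2_eq by (simp add: suminf_diff[OF a, symmetric] sums_iff)
  qed
  moreover have "(\<lambda>N. suminf a - (\<Sum>n<N. a n)) \<longlonglongrightarrow> suminf a - suminf a"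
    by (intro tendsto_intros summable_LIMSEQ a)
  ultimately have "(\<lambda>N. sqrt ((norm (x - (\<Sum>n<N. l2_single n (l2_nth x n))))\<^sup>2)) \<longlonglongrightarrow> sqrt 0"
    by (intro tendsto_real_sqrt) simp
  then have "(\<lambda>N. x - (\<Sum>n<N. l2_single n (l2_nth x n))) \<longlonglongrightarrow> 0"
    by (simp add: tendsto_norm_zero_iff)
  then have "(\<lambda>N. x - (x - (\<Sum>n<N. l2_single n (l2_nth x n)))) \<longlonglongrightarrow> x - 0"
    by (intro tendsto_diff tendsto_const)
  then show ?thesis by (simp add: sums_def)
qed

lemma l2_blinfun_eqI:
  fixes F G :: "'a::real_inner l2 \<Rightarrow>\<^sub>L 'b::real_normed_vector"
  assumes "\<And>n h. F (l2_single n h) = G (l2_single n h)"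
  shows "F = G"
proof (rule blinfun_eqI)
  fix x
  have "(\<lambda>n. F (l2_single n (l2_nth x n))) sums F x"
    "(\<lambda>n. G (l2_single n (l2_nth x n))) sums G x"
    by (intro bounded_linear.sums[OF blinfun.bounded_linear_right] l2_single_sums)+
  then show "F x = G x" unfolding assms by (rule sums_unique2)
qed

locale orthonormal_embeddings =
  fixes u :: "nat \<Rightarrow> 'h::complex_hilbert \<Rightarrow>\<^sub>L 'k::complex_hilbert"
  assumes clinear_u: "clinear (u n)"
    and inner_u: "inner (u i x) (u j y) = (if i = j then inner x y else 0)"
begin

lemma adjoint_u: "blinfun_adjoint (u i) (u j x) = (if i = j then x else 0)"
  by (rule inner_eqI) (simp add: inner_adjoint_right inner_u)

text \<open>Makes the coefficient sequence of \<open>y\<close> square summable, so that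
  \<open>coords\<close> takes genuine values in \<open>l2\<close>.\<close>

lemma Bessel_inequality: "(\<Sum>n<N. (norm (blinfun_adjoint (u n) y))\<^sup>2) \<le> (norm y)\<^sup>2"
proof -
  let ?a = "\<lambda>n. blinfun_adjoint (u n) y"
  let ?p = "\<Sum>n<N. u n (?a n)"
  have "inner ?p ?p = (\<Sum>n<N. (norm (?a n))\<^sup>2)"
    by (simp add: inner_sum_left inner_sum_right inner_u power2_norm_eq_inner)
  moreover have "inner y ?p = (\<Sum>n<N. (norm (?a n))\<^sup>2)"
    by (simp add: inner_sum_right inner_adjoint_left[symmetric] power2_norm_eq_inner)
  moreover have "0 \<le> inner (y - ?p) (y - ?p)" by simp
  ultimately show ?thesis
    by (simp add: inner_diff_left inner_diff_right inner_commute[of ?p y] power2_norm_eq_inner)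
qed

definition coords :: "'k \<Rightarrow>\<^sub>L 'h l2" where
  "coords = Blinfun (\<lambda>y. Abs_l2 (\<lambda>n. blinfun_adjoint (u n) y))"

lemma l2_nth_coords: "l2_nth (coords y) n = blinfun_adjoint (u n) y"
proof -
  define c where "c y = Abs_l2 (\<lambda>n. blinfun_adjoint (u n) y)" for y
  have nth: "l2_nth (c y) = (\<lambda>n. blinfun_adjoint (u n) y)" for y
    unfolding c_def
    by (intro Abs_l2_inverse CollectI summableI_nonneg_bounded[OF _ Bessel_inequality]) simp
  have "bounded_linear c"
  proof (rule bounded_linear_intro[where K = 1])
    show "c (x + y) = c x + c y" for x y
      by (rule l2_nth_inject[THEN iffD1]) (simp only: nth plus_l2.rep_eq blinfun.add_right)
    show "c (r *\<^sub>R x) = r *\<^sub>R c x" for r x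
      by (rule l2_nth_inject[THEN iffD1]) (simp only: nth scaleR_l2.rep_eq blinfun.scaleR_right)
    fix y
    have "(norm (c y))\<^sup>2 \<le> (norm y)\<^sup>2"
      unfolding norm_l2_eq by (rule suminf_le_const[OF summable_l2_nth]) (simp add: nth Bessel_inequality)
    from power2_le_imp_le[OF this] show "norm (c y) \<le> norm y * 1" by simp
  qed
  moreover have "coords = Blinfun c"
    unfolding coords_def c_def ..
  ultimately show ?thesis by (simp add: bounded_linear_Blinfun_apply nth)
qed

text \<open>As an adjoint it is bounded at once; its explicit form is the series in
  \<open>synthesis_sums\<close>.\<close>

definition synthesis :: "'h l2 \<Rightarrow>\<^sub>L 'k" where
  "synthesis = blinfun_adjoint coords"

lemma synthesis_single: "synthesis (l2_single n h) = u n h"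
  by (rule inner_eqI)
     (simp add: synthesis_def inner_adjoint_right inner_l2_single l2_nth_coords inner_adjoint_left)

lemma coords_u: "coords (u n h) = l2_single n h"
  by (rule l2_nth_inject[THEN iffD1]) (auto simp: l2_nth_coords adjoint_u l2_single.rep_eq)

lemma coords_synthesis: "coords (synthesis x) = x"
proof -
  have "coords o\<^sub>L synthesis = id_blinfun"
    by (rule l2_blinfun_eqI) (simp add: synthesis_single coords_u)
  then show ?thesis by (metis blinfun_apply_blinfun_compose blinfun_apply_id_blinfun id_apply)
qed

lemma norm_synthesis: "norm (synthesis x) = norm x"
proof -
  have "inner (synthesis x) (synthesis x) = inner x x"
    using inner_adjoint_right[of "synthesis x" coords x]
    by (simp add: synthesis_def[symmetric] coords_synthesis)
  then show ?thesis by (simp add: norm_eq_sqrt_inner)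
qed

lemma clinear_coords: "clinear coords"
  unfolding clinear_blinfun_iff
  by (intro allI l2_nth_inject[THEN iffD1] ext)
     (simp add: l2_nth_coords scaleC_l2.rep_eq clinear_scaleC[OF clinear_adjoint[OF clinear_u]])

lemma clinear_synthesis: "clinear synthesis"
  unfolding synthesis_def by (rule clinear_adjoint[OF clinear_coords])

lemma synthesis_sums: "(\<lambda>n. u n (l2_nth x n)) sums synthesis x"
  using bounded_linear.sums[OF blinfun.bounded_linear_right[of synthesis] l2_single_sums[of x]]
  by (simp add: synthesis_single)

end

section \<open>Path sums\<close>

text \<open>\<open>column0_power V m k\<close> is the \<open>(k, 0)\<close> entry of the \<open>m\<close>-th power of the block matrix \<open>V\<close>.\<close>

fun column0_power :: "(nat \<Rightarrow> nat \<Rightarrow> 'a::real_normed_vector \<Rightarrow>\<^sub>L 'a) \<Rightarrow> nat \<Rightarrow> nat \<Rightarrow> 'a \<Rightarrow>\<^sub>L 'a" where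
  "column0_power V 0 k = (if k = 0 then id_blinfun else 0)"
| "column0_power V (Suc m) k = (\<Sum>j\<le>m. V k j o\<^sub>L column0_power V m j)"

context
  fixes V :: "nat \<Rightarrow> nat \<Rightarrow> 'a::real_normed_vector \<Rightarrow>\<^sub>L 'a"
  assumes V0: "\<And>i j. j + 1 < i \<Longrightarrow> V i j = 0"
begin

text \<open>Reaching row \<open>m\<close> from row 0 in \<open>m\<close> factors forces every factor
  to go down exactly one row, so a single product survives.\<close>

lemma column0_power_diag: "column0_power V m m = path_prod V (rev [0..<m + 1])"
proof (induction m)
  case (Suc m)
  have "column0_power V (Suc m) (Suc m) = (\<Sum>j\<in>{m}. V (Suc m) j o\<^sub>L column0_power V m j)"
    unfolding column0_power.simps by (rule sum.mono_neutral_right) (auto simp: V0)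
  then show ?case using Suc by simp
qed simp

text \<open>The tuples without the condition on the first index, built by prepending so that sums
  over them follow the recursion of matrix powers. The appended 0 is the final index and also covers
  the empty tuple.\<close>

fun paths :: "nat \<Rightarrow> nat list set" where
  "paths 0 = {[]}"
| "paths (Suc m) = (\<lambda>(rs, k). k # rs) ` (SIGMA rs:paths m. {..Suc (hd (rs @ [0]))})"

lemma paths_eq:
  "paths m = {rs. length rs = m \<and> (\<forall>i<m. (rs @ [0]) ! i \<le> Suc ((rs @ [0]) ! Suc i))}"
proof (induction m)
  case (Suc m)
  have "xs \<in> paths (Suc m) \<longleftrightarrow> length xs = Suc m \<and>
      (\<forall>i<Suc m. (xs @ [0]) ! i \<le> Suc ((xs @ [0]) ! Suc i))" for xs
  proof (cases xs)
    case (Cons k rs)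
    have "hd (rs @ [0]) = (rs @ [0]) ! 0" by (cases rs) auto
    then have "xs \<in> paths (Suc m) \<longleftrightarrow> rs \<in> paths m \<and> k \<le> Suc ((rs @ [0]) ! 0)"
      by (auto simp: Cons image_iff)
    then show ?thesis by (auto simp: Cons Suc All_less_Suc2)
  qed auto
  then show ?case by blast
qed simp

lemma finite_paths: "finite (paths m)"
  by (induction m) auto

text \<open>Read backwards from the final 0, the indices rise by at most one per step.\<close>

lemma paths_le: "rs \<in> paths m \<Longrightarrow> set rs \<subseteq> {..m} \<and> hd (rs @ [0]) \<le> m"
  by (induction m arbitrary: rs) fastforce+

lemma tuples_eq: "tuples n = {rs \<in> paths n. hd rs \<noteq> n}"
proof -
  have "int a - int b \<le> 1 \<longleftrightarrow> a \<le> Suc b" for a b by linarith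
  then show ?thesis
    using paths_le[of _ n] unfolding tuples_def paths_eq by (auto simp: atLeast0AtMost)
qed

text \<open>\<open>X\<close> restricts the first index: it is \<open>UNIV\<close> for full matrix
  powers and \<open>- {n}\<close> for \<open>tuples n\<close>.\<close>

lemma sum_paths_Suc:
  fixes f :: "nat list \<Rightarrow> 'b::comm_monoid_add"
  shows "(\<Sum>rs\<in>{rs \<in> paths (Suc m). hd rs \<in> X}. f rs) =
    (\<Sum>rs\<in>paths m. \<Sum>j\<in>{..Suc (hd (rs @ [0]))} \<inter> X. f (j # rs))"
proof -
  have "{rs \<in> paths (Suc m). hd rs \<in> X} =
      (\<lambda>(rs, k). k # rs) ` (SIGMA rs:paths m. {..Suc (hd (rs @ [0]))} \<inter> X)"
    by auto
  moreover have "inj_on (\<lambda>(rs, k). k # rs) (SIGMA rs:paths m. {..Suc (hd (rs @ [0]))} \<inter> X)"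
    by (auto simp: inj_on_def)
  ultimately show ?thesis
    by (simp add: sum.reindex sum.Sigma finite_paths case_prod_unfold)
qed

lemma sum_path_prod_Suc:
  "(\<Sum>rs\<in>{rs \<in> paths (Suc m). hd rs \<in> X}. path_prod V (k # rs @ [0])) =
    (\<Sum>j\<in>{..Suc m} \<inter> X. V k j o\<^sub>L (\<Sum>rs\<in>paths m. path_prod V (j # rs @ [0])))"
proof -
  have "(\<Sum>j\<in>{..Suc (hd (rs @ [0]))} \<inter> X. path_prod V (k # (j # rs) @ [0])) =
      (\<Sum>j\<in>{..Suc m} \<inter> X. V k j o\<^sub>L path_prod V (j # rs @ [0]))" if "rs \<in> paths m" for rs
  proof -
    \<comment> \<open>Extending the range of \<open>j\<close> to \<open>{..Suc m}\<close> adds only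
      products with a zero entry of \<open>V\<close> below the subdiagonal.\<close>
    have "j \<le> Suc (hd (rs @ [0]))" if "V k j o\<^sub>L path_prod V (j # rs @ [0]) \<noteq> 0" for j
      using that V0[of "hd (rs @ [0])" j] by (cases rs) (auto simp: not_less[symmetric])
    moreover have "hd (rs @ [0]) \<le> m" using paths_le[OF that] by simp
    ultimately show ?thesis
      by (intro sum.mono_neutral_cong_left) auto
  qed
  then have "(\<Sum>rs\<in>{rs \<in> paths (Suc m). hd rs \<in> X}. path_prod V (k # rs @ [0])) =
      (\<Sum>rs\<in>paths m. \<Sum>j\<in>{..Suc m} \<inter> X. V k j o\<^sub>L path_prod V (j # rs @ [0]))"
    unfolding sum_paths_Suc by (rule sum.cong[OF refl])
  also have "\<dots> = (\<Sum>j\<in>{..Suc m} \<inter> X. \<Sum>rs\<in>paths m. V k j o\<^sub>L path_prod V (j # rs @ [0]))"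
    by (rule sum.swap)
  also have "\<dots> = (\<Sum>j\<in>{..Suc m} \<inter> X. V k j o\<^sub>L (\<Sum>rs\<in>paths m. path_prod V (j # rs @ [0])))"
    by (simp add: bounded_bilinear.sum_right[OF bounded_bilinear_blinfun_compose])
  finally show ?thesis .
qed

text \<open>Prepending an index is left multiplication by the matrix, so both sides obey the same
  recursion.\<close>

lemma sum_paths_eq_column0_power:
  "(\<Sum>rs\<in>paths m. path_prod V (k # rs @ [0])) = column0_power V (Suc m) k"
proof (induction m arbitrary: k)
  case 0
  then show ?case by simp
next
  case (Suc m)
  show ?case
    using sum_path_prod_Suc[where m = m and X = UNIV and k = k] unfolding Suc by simp
qed

text \<open>Excluding \<open>n\<close> as first index removes exactly the term \<open>j = n\<close>
  from the \<open>(0, 0)\<close> entry of the power \<open>n + 1\<close>, the term in which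
  \<open>V 0 n\<close> would occur.\<close>

lemma sum_tuples_eq:
  assumes "0 < n"
  shows "(\<Sum>rs\<in>tuples n. path_prod V (0 # rs @ [0])) = (\<Sum>j<n. V 0 j o\<^sub>L column0_power V n j)"
proof -
  obtain m where n: "n = Suc m" using assms gr0_implies_Suc by blast
  have "{..Suc m} \<inter> - {n} = {..<n}" by (auto simp: n)
  then show ?thesis
    using sum_path_prod_Suc[where m = m and X = "- {n}" and k = 0]
    unfolding sum_paths_eq_column0_power by (simp add: tuples_eq n)
qed

end

section \<open>The dilation\<close>

text \<open>The subtracted coefficients are entries of \<open>V\<close> instead of inner products;
  for the recurrence, \<open>compression_column\<close> shows that the two agree.\<close>

fun wandering ::
  "('h::complex_hilbert \<Rightarrow>\<^sub>L 'k::complex_hilbert) \<Rightarrow> ('k \<Rightarrow>\<^sub>L 'k) \<Rightarrow> (nat \<Rightarrow> nat \<Rightarrow> 'h \<Rightarrow>\<^sub>L 'h) \<Rightarrow> nat \<Rightarrow> 'h \<Rightarrow>\<^sub>L 'k"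
where
  "wandering J w V 0 = J"
| "wandering J w V (Suc n) =
    ((w o\<^sub>L wandering J w V n) - (\<Sum>k\<le>n. wandering J w V k o\<^sub>L V k n)) o\<^sub>L op_inverse (V (Suc n) n)"

declare wandering.simps(2) [simp del]

lemma dilation_entry_below_subdiag: "n + 1 < k \<Longrightarrow> dilation_entry A k n = 0"
  by (simp add: dilation_entry.simps)

lemma adjoint_isometry:
  fixes T :: "'a::{real_inner, banach} \<Rightarrow>\<^sub>L 'b::real_inner"
  assumes "\<And>x. norm (T x) = norm x"
  shows "blinfun_adjoint T (T x) = x"
  by (rule inner_eqI) (simp add: inner_adjoint_right isometry_inner[OF assms])

text \<open>\<open>A_eq\<close> states the dilation identity with the adjoint of \<open>J\<close> in
  place of the projection onto its range.\<close>

locale dilation_recurrence =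
  fixes A :: "nat \<Rightarrow> 'h::complex_hilbert \<Rightarrow>\<^sub>L 'h" and J :: "'h \<Rightarrow>\<^sub>L 'k::complex_hilbert"
    and w :: "'k \<Rightarrow>\<^sub>L 'k"
  assumes clinear_J: "clinear J" and norm_J: "norm (J x) = norm x"
    and clinear_w: "clinear w" and norm_w: "norm (w y) = norm y"
    and A_eq: "A n x = blinfun_adjoint J ((blinfun_apply w ^^ n) (J x))"
    and inv_path_prod: "n \<ge> 1 \<Longrightarrow> op_invertible (path_prod (dilation_entry A) (rev [0..<n + 1]))"
    and inv_adjoint: "k \<ge> 1 \<Longrightarrow> op_invertible (op_adjoint (dilation_entry A k (k - 1)))"
begin

abbreviation "D \<equiv> dilation_entry A"
abbreviation "u \<equiv> wandering J w D"
abbreviation "P \<equiv> column0_power D"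

definition defect :: "nat \<Rightarrow> 'h \<Rightarrow>\<^sub>L 'h" where
  "defect n = id_blinfun - (\<Sum>i = 0..n. op_adjoint (D i n) o\<^sub>L D i n)"

lemmas inner_w = isometry_inner[of w, OF norm_w]

lemma entry_subdiag: "D (Suc n) n = op_sqrt (defect n)"
proof (cases "n = 0")
  case True
  have "D 0 0 = A 1" by (simp add: dilation_entry.simps)
  then show ?thesis using True by (simp add: defect_def dilation_entry.simps[of A "Suc 0" 0])
next
  case False
  then show ?thesis unfolding defect_def by (subst dilation_entry.simps) simp
qed

lemma entry_row0:
  assumes "0 < n"
  shows "D 0 n = (A (n + 1) - (\<Sum>j<n. D 0 j o\<^sub>L P n j)) o\<^sub>L op_inverse (path_prod D (rev [0..<n + 1]))"
  using assms sum_tuples_eq[where V = D, OF dilation_entry_below_subdiag assms]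
  by (subst dilation_entry.simps) simp

lemma entry_below:
  assumes "0 < k" "k \<le> n"
  shows "D k n = - (op_inverse (op_adjoint (D k (k - 1)))
           o\<^sub>L (\<Sum>i = 0..k - 1. op_adjoint (D i (k - 1)) o\<^sub>L D i n))"
  using assms by (subst dilation_entry.simps) auto

text \<open>The induction invariant. Column \<open>m\<close> in the last clause involves
  \<open>u (Suc m)\<close>, hence the strict bound \<open>m < n\<close>.\<close>

definition stage :: "nat \<Rightarrow> bool" where
  "stage n \<longleftrightarrow> (\<forall>k\<le>n. clinear (u k)) \<and>
    (\<forall>i\<le>n. \<forall>j\<le>n. \<forall>x y. inner (u i x) (u j y) = (if i = j then inner x y else 0)) \<and>
    (\<forall>m<n. \<forall>x. w (u m x) = (\<Sum>k\<le>Suc m. u k (D k m x)))"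

text \<open>By the last clause of \<open>stage\<close>, \<open>w\<close> acts on the embeddings
  through the columns of \<open>D\<close>; powers up to \<open>n\<close> involve only columns below
  \<open>n\<close>.\<close>

lemma power_w_J:
  assumes "stage n" "m \<le> n"
  shows "(blinfun_apply w ^^ m) (J x) = (\<Sum>k\<le>m. u k (P m k x))"
  using assms(2)
proof (induction m)
  case (Suc m)
  have "(blinfun_apply w ^^ Suc m) (J x) = (\<Sum>j\<le>m. \<Sum>k\<le>Suc j. u k (D k j (P m j x)))"
    using assms(1) Suc by (simp add: stage_def blinfun.sum_right)
  also have "\<dots> = (\<Sum>j\<le>m. \<Sum>k\<le>Suc m. u k (D k j (P m j x)))"
    by (intro sum.cong refl sum.mono_neutral_left) (auto simp: dilation_entry_below_subdiag)
  also have "\<dots> = (\<Sum>k\<le>Suc m. \<Sum>j\<le>m. u k (D k j (P m j x)))"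
    by (rule sum.swap)
  also have "\<dots> = (\<Sum>k\<le>Suc m. u k (P (Suc m) k x))"
    by (simp add: blinfun.sum_right blinfun.sum_left)
  finally show ?case .
qed simp

lemma inv_P:
  assumes "0 < n"
  shows "op_invertible (P n n)"
  using inv_path_prod[of n] assms column0_power_diag[of D n, OF dilation_entry_below_subdiag]
  by simp

section \<open>Inductive step: column \<open>n\<close> and the next embedding\<close>

context
  fixes n
  assumes stage: "stage n"
begin

lemma clinear_u: "k \<le> n \<Longrightarrow> clinear (u k)"
  using stage by (simp add: stage_def)

lemma inner_u: "i \<le> n \<Longrightarrow> j \<le> n \<Longrightarrow> inner (u i x) (u j y) = (if i = j then inner x y else 0)"
  using stage by (simp add: stage_def)

lemma w_u: "m < n \<Longrightarrow> w (u m x) = (\<Sum>k\<le>Suc m. u k (D k m x))"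
  using stage by (simp add: stage_def)

lemma adjoint_u: "i \<le> n \<Longrightarrow> j \<le> n \<Longrightarrow> blinfun_adjoint (u i) (u j x) = (if i = j then x else 0)"
  by (rule inner_eqI) (simp add: inner_adjoint_right inner_u)

lemma compression_eq_entry:
  assumes "i \<le> n" "m < n"
  shows "blinfun_adjoint (u i) (w (u m x)) = D i m x"
proof -
  have "blinfun_adjoint (u i) (w (u m x)) = (\<Sum>k\<le>Suc m. if k = i then D i m x else 0)"
    unfolding w_u[OF assms(2)] blinfun.sum_right
    using assms by (intro sum.cong) (auto simp: adjoint_u)
  \<comment> \<open>If \<open>i > Suc m\<close>, no summand matches and the entry is zero as
    well.\<close>
  also have "\<dots> = D i m x" by (auto simp: dilation_entry_below_subdiag)
  finally show ?thesis .
qed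

lemma clinear_compression:
  assumes "i \<le> n" "j \<le> n" "\<And>x. blinfun_adjoint (u i) (w (u j x)) = D i j x"
  shows "clinear (D i j)"
proof -
  have "D i j = blinfun_adjoint (u i) o\<^sub>L w o\<^sub>L u j"
    by (rule blinfun_eqI) (simp add: assms(3))
  then show ?thesis
    using assms(1,2) by (simp add: clinear_compose clinear_adjoint clinear_u clinear_w)
qed

text \<open>The vector \<open>g\<close> is chosen so that the component of \<open>w^n J g\<close>
  along \<open>u n\<close> is \<open>x\<close>. The dilation identity for \<open>A (n + 1)\<close>
  at \<open>g\<close> then determines the unknown compression, and solving for it is the row 0
  formula.\<close>

lemma compression_row0: "blinfun_adjoint (u 0) (w (u n x)) = D 0 n x"
proof (cases "n = 0")
  case True
  then show ?thesis using A_eq[of 1] by (simp add: dilation_entry.simps)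
next
  case False
  define g where "g = op_inverse (P n n) x"
  have g: "P n n g = x" unfolding g_def using False by (simp add: inv_P)
  have "A (n + 1) g = blinfun_adjoint J (w ((blinfun_apply w ^^ n) (J g)))"
    by (simp add: A_eq)
  also have "\<dots> = (\<Sum>k\<le>n. blinfun_adjoint (u 0) (w (u k (P n k g))))"
    by (simp add: power_w_J[OF stage] blinfun.sum_right)
  also have "\<dots> = (\<Sum>k<n. blinfun_adjoint (u 0) (w (u k (P n k g)))) + blinfun_adjoint (u 0) (w (u n x))"
    unfolding lessThan_Suc_atMost[symmetric] sum.lessThan_Suc by (simp only: g)
  also have "(\<Sum>k<n. blinfun_adjoint (u 0) (w (u k (P n k g)))) = (\<Sum>k<n. D 0 k (P n k g))"
    by (intro sum.cong refl) (simp only: compression_eq_entry[of 0] lessThan_iff le0)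
  finally have "blinfun_adjoint (u 0) (w (u n x)) = A (n + 1) g - (\<Sum>k<n. D 0 k (P n k g))"
    by simp
  also have "\<dots> = D 0 n x"
    using entry_row0[of n] False column0_power_diag[of D n, OF dilation_entry_below_subdiag]
    by (simp add: g_def blinfun.sum_left blinfun.diff_left)
  finally show ?thesis .
qed

text \<open>For \<open>0 < k\<close>, the recurrence for \<open>D k n\<close> expresses that \<open>w\<close> preserves the orthogonality of
  \<open>u (k - 1)\<close> and \<open>u n\<close>.\<close>

lemma compression_column:
  "k \<le> n \<Longrightarrow> blinfun_adjoint (u k) (w (u n x)) = D k n x"
proof (induction k rule: less_induct)
  case (less k)
  show ?case
  proof (cases "k = 0")
    case True
    then show ?thesis by (simp only: compression_row0)
  next
    case False
    define v where "v i = blinfun_adjoint (u i) (w (u n x))" for i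
    let ?T = "\<lambda>i. op_adjoint (D i (k - 1))"
    have k: "k - 1 < n" "k - 1 \<le> n" "Suc (k - 1) = k" using less.prems False by auto
    \<comment> \<open>Column \<open>k - 1\<close> is already known to consist of compressions, so
      its entries are complex linear and their \<open>op_adjoint\<close> is a true adjoint.\<close>
    have T: "inner z (?T i y) = inner (D i (k - 1) z) y" if "i \<le> k" for i y z
    proof -
      have "clinear (D i (k - 1))"
        using that less.prems k by (intro clinear_compression compression_eq_entry) auto
      then show ?thesis by (simp add: op_adjoint_eq inner_adjoint_right)
    qed
    \<comment> \<open>Paired with \<open>z\<close>, the sum is the inner product of
      \<open>w (u (k - 1) z)\<close> and \<open>w (u n x)\<close>, which vanishes because
      \<open>w\<close> is isometric and \<open>k - 1 < n\<close>.\<close>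
    have "(\<Sum>i\<le>k. ?T i (v i)) = 0"
    proof (rule inner_eqI)
      fix z
      have "inner z (\<Sum>i\<le>k. ?T i (v i)) = (\<Sum>i\<le>k. inner (u i (D i (k - 1) z)) (w (u n x)))"
        unfolding inner_sum_right
        by (intro sum.cong refl) (simp only: T v_def inner_adjoint_right atMost_iff)
      also have "\<dots> = inner (w (u (k - 1) z)) (w (u n x))"
        by (simp only: w_u[OF k(1)] inner_sum_left k(3))
      also have "\<dots> = 0" using k by (simp add: inner_w inner_u)
      finally show "inner z (\<Sum>i\<le>k. ?T i (v i)) = inner z 0" by simp
    qed
    moreover have "{..k} = insert k {0..k - 1}" using False by auto
    \<comment> \<open>Solve for the term \<open>i = k\<close>; the remaining \<open>v i\<close> are
      entries by the induction hypothesis.\<close>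
    ultimately have "?T k (v k) = - (\<Sum>i = 0..k - 1. ?T i (v i))"
      using False by (simp add: eq_neg_iff_add_eq_0)
    also have "\<dots> = - (\<Sum>i = 0..k - 1. ?T i (D i n x))"
      using less False by (simp add: v_def)
    finally have "op_inverse (?T k) (?T k (v k)) = D k n x"
      using False less.prems by (simp add: entry_below blinfun.minus_left blinfun.minus_right blinfun.sum_left)
    then show ?thesis using inv_adjoint[of k] False by (simp add: v_def)
  qed
qed

lemma clinear_entry: "i \<le> n \<Longrightarrow> clinear (D i n)"
  by (intro clinear_compression compression_column order_refl)

lemma inner_defect: "inner (defect n x) y = inner x y - (\<Sum>k\<le>n. inner (D k n x) (D k n y))"
proof -
  have "inner (op_adjoint (D k n) z) y = inner z (D k n y)" if "k \<le> n" for k z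
    using clinear_entry[OF that] by (simp add: op_adjoint_eq inner_adjoint_left)
  then show ?thesis
    by (simp add: defect_def blinfun.diff_left blinfun.sum_left inner_diff_left inner_sum_left atLeast0AtMost)
qed

lemma inner_u_w: "k \<le> n \<Longrightarrow> inner (u k x) (w (u n y)) = inner x (D k n y)"
  by (simp add: inner_adjoint_right[symmetric] compression_column)

definition "remainder x = w (u n x) - (\<Sum>k\<le>n. u k (D k n x))"

lemma inner_u_remainder: "i \<le> n \<Longrightarrow> inner (u i z) (remainder x) = 0"
proof -
  assume i: "i \<le> n"
  have "inner (u i z) (\<Sum>k\<le>n. u k (D k n x)) = (\<Sum>k\<le>n. if k = i then inner z (D i n x) else 0)"
    unfolding inner_sum_right using i by (intro sum.cong) (auto simp: inner_u)
  then show ?thesis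
    using i by (simp add: remainder_def inner_diff_right inner_u_w)
qed

text \<open>The remainder is orthogonal to every \<open>u k\<close> with \<open>k \<le> n\<close>,
  so one of the two factors may be replaced by \<open>w (u n y)\<close>. This Gram formula is the
  source of positivity of the defect.\<close>

lemma inner_remainder: "inner (remainder x) (remainder y) = inner (defect n x) y"
proof -
  have "inner (remainder x) (remainder y) = inner (remainder x) (w (u n y))"
    by (subst (2) remainder_def)
       (simp add: inner_diff_right inner_sum_right inner_u_remainder inner_commute[of "remainder x" "u _ _"])
  also have "\<dots> = inner x y - (\<Sum>k\<le>n. inner (D k n x) (D k n y))"
    by (simp add: remainder_def inner_diff_left inner_sum_left inner_w inner_u inner_u_w)
  finally show ?thesis by (simp add: inner_defect)
qed

lemma op_positive_defect: "op_positive (defect n)"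
  unfolding op_positive_iff real_positive_def
proof (intro conjI allI)
  show "clinear (defect n)"
    unfolding defect_def clinear_blinfun_iff
    by (simp add: blinfun.diff_left blinfun.sum_left clinear_scaleC clinear_entry
        op_adjoint_eq clinear_adjoint complex_vector.scale_sum_right complex_vector.scale_right_diff_distrib)
  show "inner (defect n x) y = inner x (defect n y)" for x y
    by (simp add: inner_defect inner_commute[of x "defect n y"] inner_commute[of y x]
        inner_commute[of "D _ n y" "D _ n x"])
  show "0 \<le> inner (defect n x) x" for x
    by (simp add: inner_remainder[symmetric])
qed

text \<open>The invertibility hypothesis concerns the adjoint; it passes to the entry because a
  positive operator is its own adjoint.\<close>

lemma entry_subdiag_props:
  "op_positive (D (Suc n) n)" "D (Suc n) n o\<^sub>L D (Suc n) n = defect n" "op_invertible (D (Suc n) n)"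
proof -
  have "inner (defect n x) x \<le> inner x x" for x
    by (simp add: inner_defect sum_nonneg)
  from op_sqrt_props[OF op_positive_defect this]
  show pos: "op_positive (D (Suc n) n)" and "D (Suc n) n o\<^sub>L D (Suc n) n = defect n"
    by (simp_all add: entry_subdiag)
  have "op_adjoint (D (Suc n) n) = D (Suc n) n"
    using pos by (simp add: op_positive_iff op_adjoint_eq adjoint_real_positive)
  then show "op_invertible (D (Suc n) n)" using inv_adjoint[of "Suc n"] by simp
qed

lemma u_Suc: "u (Suc n) x = remainder (op_inverse (D (Suc n) n) x)"
  by (simp add: wandering.simps(2) remainder_def blinfun.diff_left blinfun.sum_left)

lemma stage_Suc: "stage (Suc n)"
proof -
  let ?R = "D (Suc n) n"
  have R: "clinear ?R" "real_positive ?R" using entry_subdiag_props(1) by (simp_all add: op_positive_iff)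
  note inv = entry_subdiag_props(3)
  have lin: "clinear (u (Suc n))"
    unfolding clinear_blinfun_iff u_Suc remainder_def
    by (simp add: clinear_scaleC[OF clinear_op_inverse[OF inv R(1)]] clinear_scaleC[OF clinear_w]
        clinear_scaleC clinear_u clinear_entry
        complex_vector.scale_sum_right complex_vector.scale_right_diff_distrib)
  have orth: "inner (u i x) (u (Suc n) y) = 0" if "i \<le> n" for i x y
    unfolding u_Suc by (rule inner_u_remainder[OF that])
  have iso: "inner (u (Suc n) x) (u (Suc n) y) = inner x y" for x y
  proof -
    \<comment> \<open>The Gram operator is \<open>?R\<close> squared, so normalising by the inverse
      of \<open>?R\<close> on both sides leaves the identity.\<close>
    have "defect n z = ?R (?R z)" for z
      using entry_subdiag_props(2) by (metis blinfun_apply_blinfun_compose)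
    then have "inner (u (Suc n) x) (u (Suc n) y) = inner (?R x) (op_inverse ?R y)"
      unfolding u_Suc inner_remainder by (simp add: inv)
    also have "\<dots> = inner x (?R (op_inverse ?R y))"
      using R(2) unfolding real_positive_def by blast
    finally show ?thesis by (simp add: inv)
  qed
  \<comment> \<open>Undoing the normalisation, \<open>u (Suc n)\<close> applied to
    \<open>?R x\<close> is the remainder of \<open>w (u n x)\<close>.\<close>
  have "w (u n x) = (\<Sum>k\<le>Suc n. u k (D k n x))" for x
    using u_Suc[of "?R x"] by (simp add: inv remainder_def)
  then show ?thesis
    unfolding stage_def
    using lin iso orth orth[THEN trans[OF inner_commute]] clinear_u inner_u w_u
    by (auto simp: le_Suc_eq less_Suc_eq)
qed

end

lemma stage: "stage n"
proof (induction n)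
  case 0
  then show ?case by (simp add: stage_def clinear_J isometry_inner[OF norm_J])
next
  case (Suc n)
  then show ?case by (rule stage_Suc)
qed

section \<open>Transport of the dilation to the direct sum\<close>

sublocale embeddings: orthonormal_embeddings u
proof (rule orthonormal_embeddings.intro)
  show "clinear (u n)" for n by (rule clinear_u[OF stage order_refl])
  show "inner (u i x) (u j y) = (if i = j then inner x y else 0)" for i j x y
    by (rule inner_u[OF stage[of "max i j"]]) simp_all
qed

text \<open>Formally a compression of \<open>w\<close>; by \<open>synthesis_shift\<close> it is the
  restriction of \<open>w\<close> to an invariant subspace.\<close>

definition shift :: "'h l2 \<Rightarrow>\<^sub>L 'h l2" where
  "shift = embeddings.coords o\<^sub>L w o\<^sub>L embeddings.synthesis"

text \<open>It suffices to check single summands, where \<open>w (u n h)\<close> is a finite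
  combination of the embeddings, so applying \<open>coords\<close> loses nothing.\<close>

lemma synthesis_shift: "embeddings.synthesis (shift x) = w (embeddings.synthesis x)"
proof -
  have "embeddings.synthesis o\<^sub>L shift = w o\<^sub>L embeddings.synthesis"
    by (rule l2_blinfun_eqI)
       (simp add: shift_def embeddings.synthesis_single w_u[OF stage lessI] blinfun.sum_right
         blinfun.add_right embeddings.coords_u)
  then show ?thesis by (metis blinfun_apply_blinfun_compose)
qed

lemma synthesis_shift_power:
  "embeddings.synthesis ((blinfun_apply shift ^^ n) (l2_embed h)) = (blinfun_apply w ^^ n) (J h)"
  by (induction n) (simp_all add: synthesis_shift l2_embed_eq_single embeddings.synthesis_single)

lemma synthesis_inject: "embeddings.synthesis x = embeddings.synthesis y \<longleftrightarrow> x = y"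
  by (metis embeddings.coords_synthesis)

lemma clinear_isometry_shift: "clinear_isometry shift"
  unfolding clinear_isometry_def
proof (intro conjI allI)
  show "clinear shift"
    unfolding shift_def
    by (intro clinear_compose embeddings.clinear_coords embeddings.clinear_synthesis clinear_w)
  show "norm (shift x) = norm x" for x
    by (metis embeddings.norm_synthesis synthesis_shift norm_w)
qed

lemma has_block_matrix_shift: "has_block_matrix shift D"
  unfolding has_block_matrix_def
proof (intro allI)
  fix x i
  have "(\<lambda>j. (blinfun_adjoint (u i) o\<^sub>L w) (u j (l2_nth x j))) sums
      (blinfun_adjoint (u i) o\<^sub>L w) (embeddings.synthesis x)"
    by (intro bounded_linear.sums[OF blinfun.bounded_linear_right] embeddings.synthesis_sums)
  moreover have "blinfun_adjoint (u i) (w (u j y)) = D i j y" for j y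
    \<comment> \<open>This stage contains both the embedding \<open>u i\<close> and the complete
      column \<open>j\<close>.\<close>
    by (rule compression_eq_entry[OF stage[of "max i (Suc j)"]]) auto
  ultimately show "(\<lambda>j. D i j (l2_nth x j)) sums l2_nth (shift x) i"
    by (simp add: shift_def embeddings.l2_nth_coords)
qed

text \<open>The isometry \<open>embeddings.synthesis\<close> carries \<open>l2_embed\<close> to
  \<open>J\<close> and \<open>shift\<close> to \<open>w\<close>, so the compressed powers are those
  of the given dilation.\<close>

lemma isometric_dilation_shift: "isometric_dilation A l2_embed shift"
  unfolding isometric_dilation_def
proof (intro conjI allI clinear_isometry_shift)
  have norm: "norm (l2_single k h) = norm h" for k and h :: 'h
    by (simp add: norm_eq_sqrt_inner inner_l2_single l2_single.rep_eq)
  have lin: "clinear (l2_embed :: 'h \<Rightarrow> 'h l2)"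
    unfolding clinear_iff
    by (auto simp: l2_nth_inject[symmetric] plus_l2.rep_eq scaleC_l2.rep_eq l2_embed.rep_eq)
  show iso: "clinear_isometry (l2_embed :: 'h \<Rightarrow> 'h l2)"
    using lin norm by (simp add: clinear_isometry_def l2_embed_eq_single)
  fix n h
  let ?e = "Blinfun l2_embed :: 'h \<Rightarrow>\<^sub>L 'h l2"
  let ?y = "(blinfun_apply shift ^^ n) (l2_embed h)"
  have e: "blinfun_apply ?e = l2_embed"
    by (rule bounded_linear_Blinfun_apply[OF clinear_isometry_bounded[OF iso]])
  have "orth_proj (range l2_embed) ?y = l2_embed (blinfun_adjoint ?e ?y)"
    by (rule orth_proj_range[of ?e ?y, unfolded e, OF lin]) (simp add: l2_embed_eq_single norm)
  also have "blinfun_adjoint ?e ?y = A n h"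
  proof (rule inner_eqI)
    fix z
    have "inner z (blinfun_adjoint ?e ?y) = inner ?y (l2_single 0 z)"
      unfolding inner_adjoint_right e by (simp add: l2_embed_eq_single inner_commute)
    also have "\<dots> = inner (embeddings.synthesis ?y) (embeddings.synthesis (l2_single 0 z))"
      by (simp add: isometry_inner[OF embeddings.norm_synthesis])
    also have "\<dots> = inner z (A n h)"
      by (simp add: synthesis_shift_power embeddings.synthesis_single A_eq inner_adjoint_right inner_commute)
    finally show "inner z (blinfun_adjoint ?e ?y) = inner z (A n h)" .
  qed
  finally show "l2_embed (A n h) = orth_proj (range l2_embed) ?y" ..
qed

lemma closure_span_shift:
  "closure (complex_vector.span {(blinfun_apply shift ^^ n) (l2_embed h) |n h. True}) = UNIV"
    (is "closure (complex_vector.span ?S) = _")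
proof -
  have single: "l2_single n h \<in> complex_vector.span ?S" for n h
  proof (induction n arbitrary: h rule: less_induct)
    case (less n)
    \<comment> \<open>With this \<open>g\<close> the last component is \<open>h\<close>, and the
      others lie in the span by induction. For \<open>n = 0\<close>, \<open>P 0 0\<close> is the
      identity.\<close>
    define g where "g = (if n = 0 then h else op_inverse (P n n) h)"
    have g: "P n n g = h" by (simp add: g_def inv_P)
    have "(blinfun_apply shift ^^ n) (l2_embed g) = (\<Sum>k\<le>n. l2_single k (P n k g))"
      by (rule synthesis_inject[THEN iffD1])
         (simp add: synthesis_shift_power power_w_J[OF stage order_refl] blinfun.sum_right
           embeddings.synthesis_single)
    also have "\<dots> = (\<Sum>k<n. l2_single k (P n k g)) + l2_single n h"
      unfolding lessThan_Suc_atMost[symmetric] sum.lessThan_Suc g ..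
    finally have "l2_single n h = (blinfun_apply shift ^^ n) (l2_embed g) - (\<Sum>k<n. l2_single k (P n k g))"
      by simp
    also have "\<dots> \<in> complex_vector.span ?S"
      by (intro complex_vector.span_diff complex_vector.span_sum complex_vector.span_base less) auto
    finally show ?case .
  qed
  have "x \<in> closure (complex_vector.span ?S)" for x
    unfolding closure_sequential
  proof (intro exI conjI allI)
    show "(\<Sum>n<N. l2_single n (l2_nth x n)) \<in> complex_vector.span ?S" for N
      by (intro complex_vector.span_sum single)
    show "(\<lambda>N. \<Sum>n<N. l2_single n (l2_nth x n)) \<longlonglongrightarrow> x"
      using l2_single_sums[of x] by (simp only: sums_def)
  qed
  then show ?thesis by blast
qed

end

theorem theorem3p2:
  fixes A :: "nat \<Rightarrow> 'h::complex_hilbert \<Rightarrow>\<^sub>L 'h"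
    and J :: "'h \<Rightarrow> 'k::complex_hilbert" and W :: "'k \<Rightarrow> 'k"
  assumes "\<And>n. clinear (A n)" and "\<And>n. norm (A n) \<le> 1" and "A 0 = id_blinfun"
    and "isometric_dilation A J W"
    and "\<And>n. n \<ge> 1 \<Longrightarrow> op_invertible (path_prod (dilation_entry A) (rev [0..<n + 1]))"
    and "\<And>k. k \<ge> 1 \<Longrightarrow> op_invertible (op_adjoint (dilation_entry A k (k - 1)))"
  shows "(\<forall>n. op_positive (id_blinfun
            - (\<Sum>i = 0..n. op_adjoint (dilation_entry A i n) o\<^sub>L dilation_entry A i n)))
       \<and> (\<exists>V :: 'h l2 \<Rightarrow> 'h l2. has_block_matrix V (dilation_entry A)
            \<and> minimal_isometric_dilation A l2_embed V)"
proof -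
  have iso: "clinear_isometry J" "clinear_isometry W"
    and dil: "\<And>n h. J (A n h) = orth_proj (range J) ((W ^^ n) (J h))"
    using assms(4) by (simp_all add: isometric_dilation_def)
  have J: "blinfun_apply (Blinfun J) = J" and W: "blinfun_apply (Blinfun W) = W"
    by (intro bounded_linear_Blinfun_apply clinear_isometry_bounded iso)+
  interpret dilation_recurrence A "Blinfun J" "Blinfun W"
  proof (rule dilation_recurrence.intro)
    show "clinear (Blinfun J)" "clinear (Blinfun W)" "\<And>x. norm (Blinfun J x) = norm x"
      "\<And>x. norm (Blinfun W x) = norm x"
      using iso by (simp_all add: J W clinear_isometry_def)
    then have proj: "orth_proj (range J) y = J (blinfun_adjoint (Blinfun J) y)"
      and adj: "blinfun_adjoint (Blinfun J) (J x) = x" for x y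
      using orth_proj_range[of "Blinfun J" y] adjoint_isometry[of "Blinfun J" x] by (simp_all add: J)
    \<comment> \<open>Apply the adjoint of \<open>J\<close> to \<open>dil\<close>: after rewriting
      the projection by \<open>proj\<close>, \<open>adj\<close> cancels \<open>J\<close> on both
      sides.\<close>
    show "A n x = blinfun_adjoint (Blinfun J) ((blinfun_apply (Blinfun W) ^^ n) (Blinfun J x))" for n x
      using arg_cong[OF dil[of n x], of "blinfun_adjoint (Blinfun J)"] by (simp add: proj adj J W)
  qed (use assms(5,6) in blast)+
  show ?thesis
    \<comment> \<open>\<open>op_positive_defect\<close> at every stage gives the first conjunct:
      each square root in the recurrence is taken of a positive operator.\<close>
    using op_positive_defect[OF stage] has_block_matrix_shift isometric_dilation_shift closure_span_shift
    unfolding defect_def minimal_isometric_dilation_def by blast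
qed

end
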